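(* Let $(X_t)_{t\ge1}$ be a sequence of random vectors in $\mathbb{R}^d$ such that $\|X_t\|\le1/2$ almost surely for all $t\ge1$, and let $(\mathcal{F}_t)_{t\ge0}$ be a filtration to which $(X_t)_{t\ge1}$ is adapted. Let $S_t:=\sum_{s=1}^t(X_s-\mathbb{E}[X_s\mid\mathcal{F}_{s-1}])$, $\widehat\mu_t:=t^{-1}\sum_{s=1}^tX_s$ for $t\ge1$ and $\widehat\mu_0:=0$, and $V_t:=\sum_{s=1}^t(X_s-\widehat\mu_{s-1})(X_s-\widehat\mu_{s-1})^\top$. Then $(S_t)_{t\ge0}$ is sub-$\psi_{E,1}$ with variance proxy $(V_t)_{t\ge0}$, where $\psi_{E,1}(\lambda)=-\log(1-\lambda)-\lambda$ on $[0,1)$. Consequently, let $\rho>0$, $\alpha>1$, $\beta>1$, $\epsilon\in(0,1)$, $\delta\in(0,1)$, let $h:[0,\infty)\to(0,\infty)$ be increasing with $\sum_{k=0}^\infty h(k)^{-1}\le1$, and for a positive semi-definite $d\times d$ matrix $V$ put $$L^\delta_\rho(V):=\log\left(h\left(\log_\alpha\left(\frac{\gamma_{\max}(V\lor\rho I_d)}{\rho}\right)\right)\right)+\log\left(\frac1\delta\cdot\frac{1}{1-\beta^{-1}}\right)+\log\left(\beta\sqrt{\kappa(V\lor\rho I_d)}\cdot N_{d-1}\left(\frac{\epsilon}{\beta\sqrt{\kappa(V\lor\rho I_d)}}\right)\right).$$ Then $$\mathbb{P}\left(\exists t\ge0:\left\|(V_t\lor\rho I_d)^{-1/2}S_t\right\|\ge\frac{\sqrt{\gamma_{\min}(V_t\lor\rho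 I_d)}}{1-\epsilon}\cdot(\psi_{E,1}^* )^{-1}\left(\frac{\alpha L^\delta_\rho(V_t)}{\gamma_{\min}(V_t\lor\rho I_d)}\right)\right)\le\delta.$$ In particular, with probability at least $1-\delta$, simultaneously for all $t\ge0$, $$\left\|(V_t\lor\rho I_d)^{-1/2}S_t\right\|\le\frac{1}{1-\epsilon}\left[\sqrt{2\alpha L^\delta_\rho(V_t)}+\frac{\alpha L^\delta_\rho(V_t)}{\sqrt{\gamma_{\min}(V_t\lor\rho I_d)}}\right].$$
   Context: Time $t$ ranges over $\{0,1,2,\dots\}$ (empty sums are $0$); $\|\cdot\|$ and $\langle\cdot,\cdot\rangle$ are the Euclidean norm and inner product; $\mathbb{S}^{d-1}$ is the Euclidean unit sphere in $\mathbb{R}^d$; $a\lor b=\max\{a,b\}$. Matrices: for a $d\times d$ symmetric positive semi-definite $V$, $\gamma_{\max}(V),\gamma_{\min}(V)$ are its largest and smallest eigenvalues and $\kappa(V)=\gamma_{\max}(V)/\gamma_{\min}(V)$. If $V=\sum_n\gamma_n v_nv_n^\top$ is a spectral decomposition with orthonormal eigenvectors, $V\lor\rho I_d:=\sum_n(\gamma_n\lor\rho)v_nv_n^\top$. Covering number: $N_{d-1}(\epsilon)$ is the smallest cardinality of a set $K\subset\mathbb{S}^{d-1}$ such that every $x\in\mathbb{S}^{d-1}$ has some $y\in K$ with $\|x-y\|\le\epsilon$. Convex conjugate: $\psi_{E,1}^*(u)=\sup_{\lambda\in[0,1)}(u\lambda-\psi_{E,1}(\lambda))$ for $u\in[0,\infty)$,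 a strictly increasing bijection of $[0,\infty)$ with inverse $(\psi_{E,1}^* )^{-1}$. Sub-$\psi$ (vector), for $\psi:[0,\lambda_{\max})\to[0,\infty)$: let $(S_t)_{t\ge0}$ be $\mathbb{R}^d$-valued and $(V_t)_{t\ge0}$ be valued in $d\times d$ positive semi-definite matrices, both adapted to a filtration $(\mathcal{F}_t)_{t\ge0}$. $(S_t)$ is sub-$\psi$ with variance proxy $(V_t)$ if for every $\nu\in\mathbb{S}^{d-1}$ and $\lambda\in[0,\lambda_{\max})$ there is a non-negative supermartingale $(L_t)_{t\ge0}$ with respect to $(\mathcal{F}_t)$ with $\mathbb{E}[L_0]\le1$ such that almost surely $\exp\{\lambda\langle\nu,S_t\rangle-\psi(\lambda)\langle\nu,V_t\nu\rangle\}\le L_t$ for all $t\ge0$. *)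

theory Defs
  imports "HOL-Probability.Probability"
begin

definition outer_prod :: "real^'n \<Rightarrow> real^'n \<Rightarrow> real^'n^'n" where
  "outer_prod x y = (\<chi> i j. x $ i * y $ j)"

definition psd :: "real^'n^'n \<Rightarrow> bool" where
  "psd V \<longleftrightarrow> transpose V = V \<and> (\<forall>x. 0 \<le> x \<bullet> (V *v x))"

definition eigenvalues :: "real^'n^'n \<Rightarrow> real set" where
  "eigenvalues V = {c. \<exists>v. v \<noteq> 0 \<and> V *v v = c *\<^sub>R v}"

definition gamma_max :: "real^'n^'n \<Rightarrow> real" where
  "gamma_max V = Max (eigenvalues V)"

definition gamma_min :: "real^'n^'n \<Rightarrow> real" where
  "gamma_min V = Min (eigenvalues V)"

definition cond_number :: "real^'n^'n \<Rightarrow> real" where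
  "cond_number V = gamma_max V / gamma_min V"

definition spectral_decomp ::
    "real^'n^'n \<Rightarrow> ('n \<Rightarrow> real) \<Rightarrow> ('n \<Rightarrow> real^'n) \<Rightarrow> bool" where
  "spectral_decomp V g v \<longleftrightarrow>
     (\<forall>i j. v i \<bullet> v j = (if i = j then 1 else 0)) \<and>
     V = (\<Sum>i\<in>UNIV. g i *\<^sub>R outer_prod (v i) (v i))"

text \<open>A symmetric matrix has a spectral decomposition, and the matrix below does not
  depend on which one is taken, so the definite description denotes for every symmetric
  \<open>V\<close>. It is used for symmetric matrices only.\<close>

definition spectral_fun :: "(real \<Rightarrow> real) \<Rightarrow> real^'n^'n \<Rightarrow> real^'n^'n" where
  "spectral_fun f V =
     (THE W. \<exists>g v. spectral_decomp V g v \<and>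
                   W = (\<Sum>i\<in>UNIV. f (g i) *\<^sub>R outer_prod (v i) (v i)))"

definition mat_max :: "real^'n^'n \<Rightarrow> real \<Rightarrow> real^'n^'n" where
  "mat_max V \<rho> = spectral_fun (\<lambda>x. max x \<rho>) V"

definition inv_sqrt_mat :: "real^'n^'n \<Rightarrow> real^'n^'n" where
  "inv_sqrt_mat V = spectral_fun (\<lambda>x. 1 / sqrt x) V"

definition covering_number :: "'a::real_normed_vector set \<Rightarrow> real \<Rightarrow> nat" where
  "covering_number S \<epsilon> =
     (LEAST n. \<exists>K. finite K \<and> card K = n \<and> K \<subseteq> S \<and>
                   (\<forall>x\<in>S. \<exists>y\<in>K. norm (x - y) \<le> \<epsilon>))"

definition psi_E :: "real \<Rightarrow> real" where
  "psi_E l = - ln (1 - l) - l"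

definition psi_E_conj :: "real \<Rightarrow> real" where
  "psi_E_conj u = (SUP l\<in>{0..<1}. u * l - psi_E l)"

definition psi_E_conj_inv :: "real \<Rightarrow> real" where
  "psi_E_conj_inv = the_inv_into {0..} psi_E_conj"

definition adapted_to ::
    "(nat \<Rightarrow> 'a measure) \<Rightarrow> (nat \<Rightarrow> 'a \<Rightarrow> 'b::topological_space) \<Rightarrow> bool" where
  "adapted_to F Y \<longleftrightarrow> (\<forall>t. Y t \<in> borel_measurable (F t))"

definition supermartingale ::
    "'a measure \<Rightarrow> (nat \<Rightarrow> 'a measure) \<Rightarrow> (nat \<Rightarrow> 'a \<Rightarrow> real) \<Rightarrow> bool" where
  "supermartingale M F L \<longleftrightarrow>
     adapted_to F L \<and> (\<forall>t. integrable M (L t)) \<and>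
     (\<forall>s t. s \<le> t \<longrightarrow> (AE \<omega> in M. real_cond_exp M (F s) (L t) \<omega> \<le> L s \<omega>))"

definition vec_cond_exp ::
    "'a measure \<Rightarrow> 'a measure \<Rightarrow> ('a \<Rightarrow> real^'n) \<Rightarrow> 'a \<Rightarrow> real^'n" where
  "vec_cond_exp M G Y \<omega> = (\<chi> i. real_cond_exp M G (\<lambda>\<omega>. Y \<omega> $ i) \<omega>)"

text \<open>The standing requirements on \<open>\<psi>\<close>, \<open>S\<close> and \<open>V\<close> (nonnegativity, adaptedness,
  positive semi-definiteness) are part of the predicate. The bound \<open>lmax\<close> is an extended
  real, so that the domain of \<open>\<psi>\<close> may be a bounded interval or the whole half-line.\<close>

definition sub_psi ::
    "'a measure \<Rightarrow> (nat \<Rightarrow> 'a measure) \<Rightarrow> ereal \<Rightarrow> (real \<Rightarrow> real) \<Rightarrow>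
     (nat \<Rightarrow> 'a \<Rightarrow> real^'n) \<Rightarrow> (nat \<Rightarrow> 'a \<Rightarrow> real^'n^'n) \<Rightarrow> bool" where
  "sub_psi M F lmax \<psi> S V \<longleftrightarrow>
     (\<forall>l. 0 \<le> l \<and> ereal l < lmax \<longrightarrow> 0 \<le> \<psi> l) \<and>
     adapted_to F S \<and> adapted_to F V \<and>
     (\<forall>t. \<forall>\<omega>\<in>space M. psd (V t \<omega>)) \<and>
     (\<forall>\<nu>\<in>sphere 0 1. \<forall>l. 0 \<le> l \<and> ereal l < lmax \<longrightarrow>
        (\<exists>L. supermartingale M F L \<and>
             (\<forall>t. \<forall>\<omega>\<in>space M. 0 \<le> L t \<omega>) \<and>
             integral\<^sup>L M (L 0) \<le> 1 \<and>
             (AE \<omega> in M. \<forall>t.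
                exp (l * (\<nu> \<bullet> S t \<omega>) - \<psi> l * (\<nu> \<bullet> (V t \<omega> *v \<nu>))) \<le> L t \<omega>)))"

text \<open>The sequence \<open>X\<close> is indexed from 1; its value at index 0 is never used.\<close>

definition S_proc ::
    "'a measure \<Rightarrow> (nat \<Rightarrow> 'a measure) \<Rightarrow> (nat \<Rightarrow> 'a \<Rightarrow> real^'n) \<Rightarrow> nat \<Rightarrow> 'a \<Rightarrow> real^'n" where
  "S_proc M F X t \<omega> = (\<Sum>s=1..t. X s \<omega> - vec_cond_exp M (F (s - 1)) (X s) \<omega>)"

definition emp_mean :: "(nat \<Rightarrow> 'a \<Rightarrow> real^'n) \<Rightarrow> nat \<Rightarrow> 'a \<Rightarrow> real^'n" where
  "emp_mean X t \<omega> = (if t = 0 then 0 else (1 / real t) *\<^sub>R (\<Sum>s=1..t. X s \<omega>))"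

definition V_proc :: "(nat \<Rightarrow> 'a \<Rightarrow> real^'n) \<Rightarrow> nat \<Rightarrow> 'a \<Rightarrow> real^'n^'n" where
  "V_proc X t \<omega> = (\<Sum>s=1..t. outer_prod (X s \<omega> - emp_mean X (s - 1) \<omega>)
                                         (X s \<omega> - emp_mean X (s - 1) \<omega>))"

definition L_fun ::
    "(real \<Rightarrow> real) \<Rightarrow> real \<Rightarrow> real \<Rightarrow> real \<Rightarrow> real \<Rightarrow> real \<Rightarrow> real^'n^'n \<Rightarrow> real" where
  "L_fun h \<alpha> \<beta> \<epsilon> \<delta> \<rho> V =
     (let W = mat_max V \<rho>; b = \<beta> * sqrt (cond_number W) in
        ln (h (log \<alpha> (gamma_max W / \<rho>)))
      + ln (1 / \<delta> * (1 / (1 - 1 / \<beta>)))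
      + ln (b * real (covering_number (sphere (0::real^'n) 1) (\<epsilon> / b))))"

end

theory Submission
  imports Defs
begin

text \<open>Fix a unit vector \<open>\<nu>\<close> and \<open>l \<in> [0, 1)\<close>. Almost surely all
  \<open>X s\<close> and all running means lie in the ball of radius one half, so
  \<open>\<nu> \<bullet> (X s - emp_mean X (s - 1))\<close> is at least \<open>-1\<close>,
  and Fan's inequality \<open>exp (l * y - psi_E l * y\<^sup>2) \<le> 1 + l * y\<close>
  applies to it (\<open>fan_inequality\<close>, in logarithmic form). Its right-hand side is
  affine in \<open>y\<close>, so its conditional expectation is explicit, and \<open>1 + z
  \<le> exp z\<close> then shows that \<open>exp (l * (\<nu> \<bullet> S t) - psi_E l *
  (\<nu> \<bullet> (V t *v \<nu>)))\<close> is a supermartingale: the running mean, being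
  predictable, cancels. This is the sub-psi property.

  For the deviation bound, Ville's inequality controls countably many linear boundaries
  \<open>l * (\<nu> \<bullet> S t) - psi_E l * (\<nu> \<bullet> (V t *v \<nu>)) \<ge>
  b\<close>, each with probability at most \<open>exp (- b)\<close>. It remains to show that
  the event of the theorem lies in the union of these crossings, and this part is
  deterministic. Let \<open>W\<close> be the regularised matrix, \<open>R\<close> its square
  root and \<open>u\<close> the normalised vector \<open>inv_sqrt_mat W *v s\<close>, so
  that \<open>\<nu> \<bullet> s = (R *v \<nu>) \<bullet> u\<close>. Some unit vector is
  mapped by \<open>R\<close> onto the ray of \<open>u\<close>; replacing it by a point
  \<open>\<nu>\<close> of an \<open>\<epsilon> / sqrt \<kappa>\<close>-cover moves its image
  by a relative error of at most \<open>\<epsilon>\<close>, hence turns it by an angle with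
  cosine at least \<open>1 - \<epsilon>\<close> (\<open>covering_direction\<close>). So
  \<open>\<nu> \<bullet> s \<ge> (1 - \<epsilon>) * sqrt q * norm u\<close> with \<open>q =
  \<nu> \<bullet> (W *v \<nu>)\<close>, and one is left with a scalar problem in the
  variance \<open>q\<close>, which lies between the extreme eigenvalues of \<open>W\<close>.

  The scalar boundary is covered by lines, one for each scale \<open>\<alpha> ^ k * \<rho>
  \<le> q \<le> \<alpha> ^ Suc k * \<rho>\<close>; within a scale the line that is optimal
  at its lower end loses only the factor \<open>\<alpha>\<close>
  (\<open>stitched_line_crossing\<close>). Passing from the smallest eigenvalue of
  \<open>W\<close> to \<open>q\<close> is possible because psi_E is super-Gaussian: the
  conjugate divided by the square is decreasing (\<open>psi_E_legendre_scale\<close>). The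
  condition number is random, so a cover is chosen for each range \<open>\<beta> ^ j \<le>
  sqrt \<kappa> < \<beta> ^ Suc j\<close>. Giving the line with indices \<open>j\<close>,
  \<open>k\<close>, \<open>\<nu>\<close> the probability \<open>\<delta> * (1 - 1 / \<beta>)
  / (\<beta> ^ j * h k)\<close> divided by the size of the cover makes the total at most
  \<open>\<delta>\<close>.

  The explicit boundary dominates this one because of \<open>psi_E_conj_inv z \<le> sqrt (2
  * z) + z\<close>. Two topics support the argument: the spectral theorem for real symmetric
  matrices, and the measurability of the spectral functions that occur in the boundary.\<close>

section \<open>The convex conjugate of the exponential CGF bound\<close>

text \<open>At \<open>l = 0\<close> both sides vanish. The \<open>l\<close>-derivative of right minus
  left is \<open>l * x\<^sup>2 * (1 / (1 - l) - 1 / (1 + l * x))\<close>, which is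
  nonnegative because \<open>x \<ge> -1\<close> gives \<open>1 - l \<le> 1 + l * x\<close>.\<close>

lemma fan_inequality:
  fixes l x :: real
  assumes "0 \<le> l" "l < 1" "- 1 \<le> x"
  shows "l * x - psi_E l * x\<^sup>2 \<le> ln (1 + l * x)"
proof -
  define g where "g = (\<lambda>s. ln (1 + s * x) - s * x + psi_E s * x\<^sup>2)"
  have pos: "0 < 1 + s * x \<and> 1 - s \<le> 1 + s * x" if "0 \<le> s" "s \<le> l" for s
    using mult_left_mono[OF assms(3) that(1)] that assms by simp
  have der: "(g has_real_derivative
      (x / (1 + s * x) - x + (1 / (1 - s) - 1) * x\<^sup>2)) (at s)" if "0 \<le> s" "s \<le> l" for s
    unfolding g_def psi_E_def using pos[OF that] that assms
    by (auto intro!: derivative_eq_intros simp: field_simps)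
  have "g 0 \<le> g l"
  proof (rule DERIV_nonneg_imp_nondecreasing[OF assms(1)])
    fix s assume s: "0 \<le> s" "s \<le> l"
    have "x / (1 + s * x) - x + (1 / (1 - s) - 1) * x\<^sup>2
        = s * x\<^sup>2 * (1 / (1 - s) - 1 / (1 + s * x))"
      using pos[OF s] s assms by (simp add: divide_simps) (simp add: algebra_simps power2_eq_square)
    also have "\<dots> \<ge> 0"
      using pos[OF s] s assms by (intro mult_nonneg_nonneg) (auto intro!: frac_le)
    finally show "\<exists>y. (g has_real_derivative y) (at s) \<and> 0 \<le> y"
      using der[OF s] by blast
  qed
  then show ?thesis by (simp add: g_def psi_E_def)
qed

lemma psi_E_nonneg: "0 \<le> psi_E l" if "l < 1"
  using ln_add_one_self_le_self2[of "-l"] that by (simp add: psi_E_def)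

text \<open>The closed form of \<open>psi_E_conj\<close> on the nonnegative half-line.\<close>

definition psi_E_legendre :: "real \<Rightarrow> real" where
  "psi_E_legendre u = u - ln (1 + u)"

text \<open>The maximiser \<open>u / (1 + u)\<close> is the slope of the line used on a scale.\<close>

lemma psi_E_legendre_attained:
  assumes "0 \<le> u"
  shows "u * (u / (1 + u)) - psi_E (u / (1 + u)) = psi_E_legendre u"
proof -
  have "1 - u / (1 + u) = 1 / (1 + u)" using assms by (simp add: field_simps)
  then have "psi_E (u / (1 + u)) = ln (1 + u) - u / (1 + u)"
    using assms by (simp add: psi_E_def ln_div)
  moreover have "u * (u / (1 + u)) + u / (1 + u) = u"
  proof -
    have "u * (u / (1 + u)) + u / (1 + u) = (1 + u) * u / (1 + u)"
      by (simp add: add_divide_distrib distrib_right)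
    also have "\<dots> = u" using assms by simp
    finally show ?thesis .
  qed
  ultimately show ?thesis by (simp add: psi_E_legendre_def)
qed

text \<open>This is \<open>ln y \<le> y - 1\<close> at \<open>y = (1 + u) * (1 - l)\<close>.\<close>

lemma psi_E_young:
  assumes "0 \<le> u" "l < 1"
  shows "u * l - psi_E l \<le> psi_E_legendre u"
proof -
  have "ln ((1 + u) * (1 - l)) \<le> (1 + u) * (1 - l) - 1"
    using assms by (intro ln_le_minus_one) simp
  moreover have "ln ((1 + u) * (1 - l)) = ln (1 + u) + ln (1 - l)"
    using assms by (simp add: ln_mult)
  moreover have "(1 + u) * (1 - l) - 1 = u - l - u * l" by (simp add: algebra_simps)
  ultimately show ?thesis unfolding psi_E_def psi_E_legendre_def by linarith
qed

lemma psi_E_conj_eq: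
  assumes "0 \<le> u"
  shows "psi_E_conj u = psi_E_legendre u"
  unfolding psi_E_conj_def
proof (rule cSup_eq_maximum)
  have "u / (1 + u) \<in> {0..<1}" using assms by auto
  then show "psi_E_legendre u \<in> (\<lambda>l. u * l - psi_E l) ` {0..<1}"
    using psi_E_legendre_attained[OF assms] by (intro image_eqI[of _ _ "u / (1 + u)"]) simp_all
  show "y \<le> psi_E_legendre u" if "y \<in> (\<lambda>l. u * l - psi_E l) ` {0..<1}" for y
    using that psi_E_young[OF assms] by auto
qed

text \<open>The super-Gaussian growth of \<open>psi_E\<close>, stated for its conjugate:
  \<open>psi_E_legendre x / x\<^sup>2\<close> decreases in \<open>x\<close>. The
  \<open>x\<close>-derivative of right minus left is \<open>c\<^sup>2 * x * (1 / (1 + c * x)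
  - 1 / (1 + x))\<close>.\<close>

lemma psi_E_legendre_scale:
  assumes "0 \<le> c" "c \<le> 1" "0 \<le> x"
  shows "c\<^sup>2 * psi_E_legendre x \<le> psi_E_legendre (c * x)"
proof -
  define g where "g = (\<lambda>s. psi_E_legendre (c * s) - c\<^sup>2 * psi_E_legendre s)"
  have "g 0 \<le> g x"
  proof (rule DERIV_nonneg_imp_nondecreasing[OF assms(3)])
    fix s assume s: "0 \<le> s" "s \<le> x"
    have p: "0 \<le> c * s" "c * s \<le> s"
      using s assms by (auto simp: mult_left_le_one_le)
    have der: "(g has_real_derivative (c - c / (1 + c * s) - c\<^sup>2 * (1 - 1 / (1 + s)))) (at s)"
      unfolding g_def psi_E_legendre_def using p s
      by (auto intro!: derivative_eq_intros)
    have "c - c / (1 + c * s) - c\<^sup>2 * (1 - 1 / (1 + s)) = c\<^sup>2 * s * (1 / (1 + c * s) - 1 / (1 + s))"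
      using p s by (simp add: divide_simps) (simp add: algebra_simps power2_eq_square)
    also have "\<dots> \<ge> 0"
      using p s by (intro mult_nonneg_nonneg) (auto intro!: frac_le)
    finally show "\<exists>y. (g has_real_derivative y) (at s) \<and> 0 \<le> y" using der by blast
  qed
  then show ?thesis by (simp add: g_def psi_E_legendre_def)
qed

lemma psi_E_legendre_strict_mono: "strict_mono_on {0..} psi_E_legendre"
proof (rule strict_mono_onI)
  fix a b :: real assume ab: "a \<in> {0..}" "b \<in> {0..}" "a < b"
  have "(1 + b) / (1 + a) = 1 + (b - a) / (1 + a)" using ab by (simp add: field_simps)
  then have "ln (1 + b) - ln (1 + a) = ln (1 + (b - a) / (1 + a))"
    using ab ln_div[of "1 + b" "1 + a"] by simp
  also have "\<dots> < (b - a) / (1 + a)"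
    using ab by (intro ln_add_one_self_less_self) auto
  also have "\<dots> \<le> b - a" using ab by (simp add: divide_le_eq mult_right_le_one_le)
  finally show "psi_E_legendre a < psi_E_legendre b" by (simp add: psi_E_legendre_def)
qed

lemma psi_E_legendre_le_iff:
  assumes "0 \<le> a" "0 \<le> b"
  shows "psi_E_legendre a \<le> psi_E_legendre b \<longleftrightarrow> a \<le> b"
  using strict_mono_on_leD[OF psi_E_legendre_strict_mono, of a b]
    strict_mono_onD[OF psi_E_legendre_strict_mono, of b a] assms by (force simp: not_le)

text \<open>With \<open>s = sqrt (2 * z)\<close> one has \<open>z = s\<^sup>2 / 2\<close>, and the claim
  becomes \<open>1 + s + s\<^sup>2 / 2 \<le> exp s\<close>.\<close>

lemma psi_E_legendre_ge:
  assumes "0 \<le> z"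
  shows "z \<le> psi_E_legendre (sqrt (2 * z) + z)"
proof -
  define s where "s = sqrt (2 * z)"
  have s: "0 \<le> s" "z = s\<^sup>2 / 2" using assms by (auto simp: s_def)
  have "1 + (s + z) \<le> exp s"
    using exp_lower_Taylor_quadratic[OF s(1)] s(2) by simp
  then have "ln (1 + (s + z)) \<le> ln (exp s)" using s assms by (subst ln_le_cancel_iff) auto
  then show ?thesis by (simp add: psi_E_legendre_def s_def)
qed

text \<open>Injectivity is strict monotonicity; surjectivity is the intermediate value theorem, with
  \<open>psi_E_legendre_ge\<close> supplying an argument whose value is large enough.\<close>

lemma psi_E_conj_bij: "bij_betw psi_E_conj {0..} {0..}"
proof -
  have "bij_betw psi_E_legendre {0..} {0..}"
    unfolding bij_betw_def
  proof
    show "inj_on psi_E_legendre {0..}"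
      by (rule strict_mono_on_imp_inj_on[OF psi_E_legendre_strict_mono])
    have nonneg: "0 \<le> psi_E_legendre u" if "0 \<le> u" for u
      using psi_E_legendre_le_iff[of 0 u] that by (simp add: psi_E_legendre_def)
    have "\<exists>u\<ge>0. psi_E_legendre u = z" if "0 \<le> z" for z
    proof -
      have "\<exists>u. 0 \<le> u \<and> u \<le> sqrt (2 * z) + z \<and> psi_E_legendre u = z"
        using that psi_E_legendre_ge[OF that]
        by (intro IVT') (auto simp: psi_E_legendre_def intro!: continuous_intros)
      then show ?thesis by blast
    qed
    then show "psi_E_legendre ` {0..} = {0..}" using nonneg by (force simp: image_iff)
  qed
  then show ?thesis using psi_E_conj_eq by (subst bij_betw_cong) auto
qed

lemma psi_E_conj_inv:
  assumes "0 \<le> z"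
  shows "0 \<le> psi_E_conj_inv z" "psi_E_legendre (psi_E_conj_inv z) = z"
proof -
  show nn: "0 \<le> psi_E_conj_inv z"
    using the_inv_into_into[OF bij_betw_imp_inj_on[OF psi_E_conj_bij], of z "{0..}"]
      psi_E_conj_bij assms by (auto simp: psi_E_conj_inv_def bij_betw_def)
  show "psi_E_legendre (psi_E_conj_inv z) = z"
    using f_the_inv_into_f_bij_betw[OF psi_E_conj_bij, of z] assms psi_E_conj_eq[OF nn]
    by (simp add: psi_E_conj_inv_def)
qed

lemma psi_E_conj_inv_le:
  assumes "0 \<le> z" "0 \<le> u" "z \<le> psi_E_legendre u"
  shows "psi_E_conj_inv z \<le> u"
  using psi_E_legendre_le_iff[of "psi_E_conj_inv z" u] psi_E_conj_inv[OF assms(1)] assms by simp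

lemma psi_E_conj_inv_mono: "mono_on {0..} psi_E_conj_inv"
  by (rule mono_onI) (simp add: psi_E_conj_inv psi_E_conj_inv_le)

lemma psi_E_conj_inv_pos: "0 < psi_E_conj_inv z" if "0 < z"
proof -
  have "psi_E_conj_inv z \<noteq> 0"
    using psi_E_conj_inv(2)[of z] that by (auto simp: psi_E_legendre_def)
  then show ?thesis using psi_E_conj_inv(1)[of z] that by linarith
qed

lemma psi_E_conj_inv_upper:
  assumes "0 \<le> z"
  shows "psi_E_conj_inv z \<le> sqrt (2 * z) + z"
  using assms by (intro psi_E_conj_inv_le psi_E_legendre_ge) auto

section \<open>Spectral calculus of symmetric matrices\<close>

lemma symmetric_matrix_inner:
  fixes V :: "real^'n^'n"
  assumes "transpose V = V"
  shows "x \<bullet> (V *v y) = (V *v x) \<bullet> y"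
  by (metis assms dot_lmul_matrix transpose_matrix_vector)

text \<open>A maximiser of the Rayleigh quotient over the unit sphere of the subspace is an eigenvector.\<close>

lemma symmetric_eigenvector_on_invariant_subspace:
  fixes V :: "real^'n^'n"
  assumes sym: "transpose V = V" and U: "subspace U" "U \<noteq> {0}"
    and inv: "\<And>x. x \<in> U \<Longrightarrow> V *v x \<in> U"
  obtains v c where "v \<in> U" "norm v = 1" "V *v v = c *\<^sub>R v"
proof -
  have "\<exists>u\<in>U. norm u = 1"
  proof -
    obtain u where u: "u \<in> U" "u \<noteq> 0" using U subspace_0 by blast
    have "(1 / norm u) *\<^sub>R u \<in> U" using u U subspace_scale by blast
    then show ?thesis using u by (intro bexI[of _ "(1 / norm u) *\<^sub>R u"]) auto
  qed
  then have ne: "sphere 0 1 \<inter> U \<noteq> {}" by auto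
  have "compact (sphere 0 1 \<inter> U)"
    by (intro compact_Int_closed closed_subspace U) simp
  moreover have "continuous_on (sphere 0 1 \<inter> U) (\<lambda>x. x \<bullet> (V *v x))"
    by (intro continuous_intros linear_continuous_on linear_linear[THEN iffD2]
        matrix_vector_mul_linear)
  ultimately obtain v where v: "v \<in> U" "norm v = 1"
    and vmax: "\<And>y. y \<in> U \<Longrightarrow> norm y = 1 \<Longrightarrow> y \<bullet> (V *v y) \<le> v \<bullet> (V *v v)"
    using continuous_attains_sup[OF _ ne, of "\<lambda>x. x \<bullet> (V *v x)"] by auto
  define c where "c = v \<bullet> (V *v v)"
  have vv: "v \<bullet> v = 1" using v by (simp add: norm_eq_1)
  have quad: "y \<bullet> (V *v y) \<le> c * (y \<bullet> y)" if "y \<in> U" for y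
  proof (cases "y = 0")
    case False
    have "(1 / norm y) *\<^sub>R y \<in> U" using that U subspace_scale by blast
    then have "((1 / norm y) *\<^sub>R y) \<bullet> (V *v ((1 / norm y) *\<^sub>R y)) \<le> c"
      unfolding c_def using False by (intro vmax) auto
    then have "(y \<bullet> (V *v y)) / (norm y)\<^sup>2 \<le> c"
      by (simp add: matrix_vector_mult_scaleR power2_eq_square)
    then show ?thesis using False by (simp add: divide_le_eq power2_norm_eq_inner)
  qed simp
  define w where "w = V *v v - c *\<^sub>R v"
  have wU: "w \<in> U" unfolding w_def using U v inv by (intro subspace_diff subspace_scale)
  have wv: "v \<bullet> w = 0" by (simp add: w_def inner_diff_right c_def vv)
  have Vv: "V *v v = w + c *\<^sub>R v" by (simp add: w_def)
  define K where "K = c * (w \<bullet> w) - w \<bullet> (V *v w)"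
  have K: "0 \<le> K" using quad[OF wU] by (simp add: K_def)
  \<comment> \<open>If the residual \<open>w\<close> were nonzero, a small step from \<open>v\<close> along \<open>w\<close> would raise the
      Rayleigh quotient to first order.\<close>
  have first_order: "2 * t * (w \<bullet> w) \<le> t\<^sup>2 * K" for t
  proof -
    have "v + t *\<^sub>R w \<in> U" using U v wU by (intro subspace_add subspace_scale)
    from quad[OF this]
    have "v \<bullet> (V *v v) + t * (v \<bullet> (V *v w)) + t * (w \<bullet> (V *v v)) + t\<^sup>2 * (w \<bullet> (V *v w))
        \<le> c * (1 + t\<^sup>2 * (w \<bullet> w))"
      by (simp add: matrix_vector_mult_scaleR matrix_vector_right_distrib inner_add_left inner_add_right vv wv
          inner_commute[of w v] power2_eq_square algebra_simps)
    moreover have "v \<bullet> (V *v w) = w \<bullet> w"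
      by (simp add: symmetric_matrix_inner[OF sym] Vv inner_add_left wv)
    moreover have "w \<bullet> (V *v v) = w \<bullet> w" by (simp add: Vv inner_add_right inner_commute[of w v] wv)
    ultimately show ?thesis by (simp add: K_def c_def algebra_simps)
  qed
  have "w \<bullet> w = 0"
  proof (rule ccontr)
    assume "w \<bullet> w \<noteq> 0"
    then have a: "0 < w \<bullet> w" by simp
    define t where "t = (w \<bullet> w) / (K + 1)"
    have t: "0 < t" using a K by (simp add: t_def)
    have "t * (2 * (w \<bullet> w)) \<le> t * (t * K)"
      using first_order[of t] by (simp add: power2_eq_square algebra_simps)
    then have "2 * (w \<bullet> w) \<le> t * K" using t by (simp only: mult_le_cancel_left_pos)
    also have "\<dots> \<le> w \<bullet> w" using K a by (simp add: t_def divide_le_eq algebra_simps)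
    finally show False using a by simp
  qed
  then have "V *v v = c *\<^sub>R v" using Vv by simp
  with v show ?thesis by (rule that)
qed

text \<open>Induction on the dimension: the orthogonal complement of an eigenvector within an invariant
  subspace is again invariant, by symmetry.\<close>

lemma symmetric_orthonormal_eigenbasis_on_invariant_subspace:
  fixes V :: "real^'n^'n"
  assumes sym: "transpose V = V" and "subspace U"
    and "\<And>x. x \<in> U \<Longrightarrow> V *v x \<in> U"
  shows "\<exists>B. B \<subseteq> U \<and> finite B \<and> card B = dim U \<and> pairwise orthogonal B \<and>
             (\<forall>b\<in>B. norm b = 1 \<and> (\<exists>c. V *v b = c *\<^sub>R b))"
  using assms(2,3)
proof (induction "dim U" arbitrary: U)
  case 0
  then show ?case by (intro exI[of _ "{}"]) auto
next
  case (Suc m)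
  have "U \<noteq> {0}" using Suc.hyps(2) by auto
  then obtain v c where v: "v \<in> U" "norm v = 1" "V *v v = c *\<^sub>R v"
    using symmetric_eigenvector_on_invariant_subspace[OF sym Suc.prems(1) _ Suc.prems(2)] by blast
  define U' where "U' = {y \<in> U. orthogonal v y}"
  have sub: "subspace U'"
    unfolding U'_def using Suc.prems(1) by (auto simp: subspace_def orthogonal_clauses)
  have "dim {y \<in> U. \<forall>x\<in>span {v}. orthogonal x y} + dim (span {v}) = dim U"
    using Suc.prems(1) v by (intro dim_subspace_orthogonal_to_vectors span_minimal) auto
  moreover have "{y \<in> U. \<forall>x\<in>span {v}. orthogonal x y} = U'"
    by (auto simp: U'_def span_singleton orthogonal_clauses)
       (metis orthogonal_def inner_scaleR_left scaleR_one)
  moreover have "dim (span {v}) = 1" using v by (auto simp: dim_span dim_singleton)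
  ultimately have dim: "m = dim U'" using Suc.hyps(2) by simp
  have inv': "V *v x \<in> U'" if "x \<in> U'" for x
    using that Suc.prems(2) v symmetric_matrix_inner[OF sym, of v x]
    by (auto simp: U'_def orthogonal_def)
  obtain B where B: "B \<subseteq> U'" "finite B" "card B = dim U'" "pairwise orthogonal B"
      "\<forall>b\<in>B. norm b = 1 \<and> (\<exists>c. V *v b = c *\<^sub>R b)"
    using Suc.hyps(1)[OF dim sub inv'] by blast
  have "v \<notin> B" using B(1) v by (auto simp: U'_def orthogonal_def)
  then show ?case
    using B v dim Suc.hyps(2)
    by (intro exI[of _ "insert v B"])
       (auto simp: U'_def pairwise_insert orthogonal_commute)
qed

lemma orthonormal_family_expand:
  fixes v :: "'n::finite \<Rightarrow> real^'n"
  assumes on: "\<forall>i j. v i \<bullet> v j = (if i = j then 1 else 0)"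
  shows "(\<Sum>i\<in>UNIV. (v i \<bullet> x) *\<^sub>R v i) = x"
proof -
  have inj: "inj v"
    by (rule injI) (metis on zero_neq_one)
  have po: "pairwise orthogonal (range v)"
    using on by (force simp: pairwise_def orthogonal_def)
  have n1: "\<And>b. b \<in> range v \<Longrightarrow> norm b = 1" using on by (auto simp: norm_eq_1)
  have "0 \<notin> range v" using n1 by (metis norm_zero zero_neq_one)
  then have ind: "independent (range v)" using po pairwise_orthogonal_independent by blast
  have "card (range v) = DIM(real^'n)" using inj by (simp add: card_image)
  then have "span (range v) = UNIV"
    using ind by (metis card_eq_dim dim_UNIV finite_imageI finite_class.finite_UNIV top_greatest top.extremum_unique span_superset le_numeral_extra subset_antisym order_refl)
  then have "x \<in> span (range v)" by simp
  then have "(\<Sum>b\<in>range v. (x \<bullet> b) *\<^sub>R b) = x"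
    using po n1 by (intro orthonormal_basis_expand) auto
  then show ?thesis using inj by (simp add: sum.reindex inner_commute)
qed

lemma outer_prod_mult: "outer_prod a b *v x = (b \<bullet> x) *\<^sub>R (a :: real^'n)"
  by (simp add: vec_eq_iff outer_prod_def matrix_vector_mult_def inner_vec_def sum_distrib_right
      sum_distrib_left mult_ac)

lemma sum_outer_prod_mult:
  "(\<Sum>i\<in>I. c i *\<^sub>R outer_prod (a i) (b i)) *v x = (\<Sum>i\<in>I. (c i * (b i \<bullet> x)) *\<^sub>R (a i :: real^'n))"
proof (cases "finite I")
  case True
  then show ?thesis
    by (induction I rule: finite_induct)
       (simp_all add: matrix_vector_mult_add_rdistrib outer_prod_mult scaleR_matrix_vector_assoc[symmetric])
qed simp

lemma spectral_decomp_exists: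
  fixes V :: "real^'n^'n"
  assumes sym: "transpose V = V"
  obtains g v where "spectral_decomp V g v"
proof -
  obtain B where B: "finite B" "card B = DIM(real^'n)" "pairwise orthogonal B"
      and Bev: "\<forall>b\<in>B. norm b = 1 \<and> (\<exists>c. V *v b = c *\<^sub>R b)"
    using symmetric_orthonormal_eigenbasis_on_invariant_subspace[OF sym subspace_UNIV]
    by (auto simp: dim_UNIV)
  have "card B = card (UNIV :: 'n set)" using B(2) by simp
  then obtain v where v: "bij_betw v (UNIV :: 'n set) B"
    using B(1) by (metis finite_same_card_bij finite_class.finite_UNIV)
  have vB: "v i \<in> B" for i using v by (auto simp: bij_betw_def)
  have on: "\<forall>i j. v i \<bullet> v j = (if i = j then 1 else 0)"
  proof (intro allI)
    fix i j
    have "i \<noteq> j \<Longrightarrow> v i \<noteq> v j" using v by (auto simp: bij_betw_def inj_on_def)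
    then show "v i \<bullet> v j = (if i = j then 1 else 0)"
      using B(3) Bev vB by (auto simp: pairwise_def orthogonal_def norm_eq_1)
  qed
  have "\<forall>i. \<exists>c. V *v v i = c *\<^sub>R v i" using Bev vB by blast
  then obtain g where g: "\<And>i. V *v v i = g i *\<^sub>R v i" by metis
  have "V *v x = (\<Sum>i\<in>UNIV. g i *\<^sub>R outer_prod (v i) (v i)) *v x" for x
  proof -
    have "V *v x = V *v (\<Sum>i\<in>UNIV. (v i \<bullet> x) *\<^sub>R v i)"
      by (simp add: orthonormal_family_expand[OF on])
    also have "\<dots> = (\<Sum>i\<in>UNIV. V *v ((v i \<bullet> x) *\<^sub>R v i))"
      by (rule linear_sum[OF matrix_vector_mul_linear])
    also have "\<dots> = (\<Sum>i\<in>UNIV. g i *\<^sub>R outer_prod (v i) (v i)) *v x"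
      by (simp add: sum_outer_prod_mult matrix_vector_mult_scaleR g mult.commute)
    finally show ?thesis .
  qed
  then have "V = (\<Sum>i\<in>UNIV. g i *\<^sub>R outer_prod (v i) (v i))" by (simp add: matrix_eq)
  then show ?thesis using on by (intro that) (simp add: spectral_decomp_def)
qed

lemma spectral_decomp_mult:
  assumes "spectral_decomp V g v"
  shows "V *v x = (\<Sum>i\<in>UNIV. (g i * (v i \<bullet> x)) *\<^sub>R v i)"
  using assms sum_outer_prod_mult[of g v v UNIV x] by (simp add: spectral_decomp_def)

lemma spectral_decomp_eigen:
  assumes "spectral_decomp V g v"
  shows "V *v v i = g i *\<^sub>R v i"
proof -
  have on: "v j \<bullet> v i = (if j = i then 1 else 0)" for j using assms by (simp add: spectral_decomp_def)
  have "V *v v i = (\<Sum>j\<in>UNIV. if j = i then g i *\<^sub>R v i else 0)"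
    unfolding spectral_decomp_mult[OF assms] by (intro sum.cong) (auto simp: on)
  then show ?thesis by simp
qed

lemma spectral_decomp_symmetric:
  assumes "spectral_decomp V g v"
  shows "transpose V = V"
  using assms
  by (simp add: spectral_decomp_def transpose_def vec_eq_iff outer_prod_def mult.commute)

text \<open>The definite description behind \<open>spectral_fun\<close> denotes: two decompositions of
  the same matrix give the same value, since an eigenvector of the one pairs nontrivially
  only with those eigenvectors of the other that belong to the same eigenvalue. Every later
  fact about \<open>spectral_fun\<close> is read off from this decomposition.\<close>

lemma spectral_decomp_fun:
  assumes "spectral_decomp V g v"
  shows "spectral_decomp (spectral_fun f V) (\<lambda>i. f (g i)) v"
proof -
  have on: "\<forall>i j. v i \<bullet> v j = (if i = j then 1 else 0)" using assms by (simp add: spectral_decomp_def)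
  let ?W = "\<lambda>g v. (\<Sum>i\<in>UNIV. f (g i) *\<^sub>R outer_prod (v i) (v i))"
  have unique: "?W g' v' = ?W g v" if d: "spectral_decomp V g' v'" for g' v'
  proof -
    have coef: "f (g' i) * (v' i \<bullet> v j) = f (g j) * (v' i \<bullet> v j)" for i j
    proof -
      \<comment> \<open>Eigenvectors of different eigenvalues are orthogonal.\<close>
      have "g' i * (v' i \<bullet> v j) = g j * (v' i \<bullet> v j)"
        using symmetric_matrix_inner[OF spectral_decomp_symmetric[OF assms], of "v' i" "v j"]
        by (auto simp: spectral_decomp_eigen[OF d] spectral_decomp_eigen[OF assms])
      then show ?thesis by (cases "v' i \<bullet> v j = 0") auto
    qed
    have on': "\<forall>i j. v' i \<bullet> v' j = (if i = j then 1 else 0)" using d by (simp add: spectral_decomp_def)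
    have eig: "?W g' v' *v v j = f (g j) *\<^sub>R v j" for j
    proof -
      have "?W g' v' *v v j = f (g j) *\<^sub>R (\<Sum>i\<in>UNIV. (v' i \<bullet> v j) *\<^sub>R v' i)"
        by (simp add: sum_outer_prod_mult coef scaleR_sum_right)
      then show ?thesis by (simp add: orthonormal_family_expand[OF on'])
    qed
    have "?W g' v' *v x = ?W g v *v x" for x
    proof -
      have "?W g' v' *v x = ?W g' v' *v (\<Sum>j\<in>UNIV. (v j \<bullet> x) *\<^sub>R v j)"
        by (simp add: orthonormal_family_expand[OF on])
      also have "\<dots> = (\<Sum>j\<in>UNIV. ?W g' v' *v ((v j \<bullet> x) *\<^sub>R v j))"
        by (rule linear_sum[OF matrix_vector_mul_linear])
      also have "\<dots> = ?W g v *v x"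
        by (simp only: matrix_vector_mult_scaleR eig) (simp add: sum_outer_prod_mult mult.commute)
      finally show ?thesis .
    qed
    then show ?thesis by (simp add: matrix_eq)
  qed
  have "spectral_fun f V = ?W g v"
    unfolding spectral_fun_def by (rule the_equality) (use assms unique in blast)+
  then show ?thesis using on by (simp add: spectral_decomp_def)
qed

lemma spectral_decomp_fun_mult:
  assumes "spectral_decomp V g v"
  shows "spectral_fun f V *v x = (\<Sum>i\<in>UNIV. (f (g i) * (v i \<bullet> x)) *\<^sub>R v i)"
  by (rule spectral_decomp_mult[OF spectral_decomp_fun[OF assms]])

lemma spectral_fun_symmetric: "transpose V = V \<Longrightarrow> transpose (spectral_fun f V) = spectral_fun f V"
  by (metis spectral_decomp_exists spectral_decomp_fun spectral_decomp_symmetric)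

lemma spectral_decomp_unique:
  assumes "spectral_decomp V g v" "spectral_decomp W g v"
  shows "V = W"
  using assms by (simp add: spectral_decomp_def)

lemma spectral_fun_spectral_fun:
  assumes "transpose V = V"
  shows "spectral_fun f (spectral_fun g V) = spectral_fun (\<lambda>x. f (g x)) V"
proof -
  obtain h v where d: "spectral_decomp V h v" using spectral_decomp_exists[OF assms] .
  show ?thesis
    by (rule spectral_decomp_unique[OF spectral_decomp_fun[OF spectral_decomp_fun[OF d]]
          spectral_decomp_fun[OF d]])
qed

lemma spectral_decomp_inner_basis:
  assumes "spectral_decomp V g v"
  shows "v j \<bullet> (V *v x) = g j * (v j \<bullet> x)"
  using symmetric_matrix_inner[OF spectral_decomp_symmetric[OF assms], of "v j" x]
  by (simp add: spectral_decomp_eigen[OF assms])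

lemma spectral_fun_mult_mult:
  assumes "transpose V = V"
  shows "spectral_fun f V *v (spectral_fun g V *v x) = spectral_fun (\<lambda>x. f x * g x) V *v x"
proof -
  obtain h v where d: "spectral_decomp V h v" using spectral_decomp_exists[OF assms] .
  show ?thesis
    by (simp add: spectral_decomp_fun_mult[OF d, of f] spectral_decomp_fun_mult[OF d, of "\<lambda>x. f x * g x"]
        spectral_decomp_inner_basis[OF spectral_decomp_fun[OF d]] mult.assoc)
qed

lemma spectral_decomp_eigenvalues:
  assumes "spectral_decomp V g v"
  shows "eigenvalues V = range g"
proof
  have on: "\<forall>i j. v i \<bullet> v j = (if i = j then 1 else 0)" using assms by (simp add: spectral_decomp_def)
  show "range g \<subseteq> eigenvalues V"
  proof clarify
    fix i
    have "v i \<noteq> 0" using on by (metis inner_zero_left zero_neq_one)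
    then show "g i \<in> eigenvalues V" using spectral_decomp_eigen[OF assms] by (auto simp: eigenvalues_def)
  qed
  show "eigenvalues V \<subseteq> range g"
  proof
    fix c assume "c \<in> eigenvalues V"
    then obtain w where w: "w \<noteq> 0" "V *v w = c *\<^sub>R w" by (auto simp: eigenvalues_def)
    have "\<exists>i. v i \<bullet> w \<noteq> 0"
    proof (rule ccontr)
      assume "\<not> (\<exists>i. v i \<bullet> w \<noteq> 0)"
      then show False using w(1) orthonormal_family_expand[OF on, of w] by simp
    qed
    then obtain i where "v i \<bullet> w \<noteq> 0" ..
    then have "g i = c" using spectral_decomp_inner_basis[OF assms, of i w] w(2) by simp
    then show "c \<in> range g" by blast
  qed
qed

lemma spectral_decomp_quadratic_form:
  assumes "spectral_decomp V g v"
  shows "x \<bullet> (V *v x) = (\<Sum>i\<in>UNIV. g i * (v i \<bullet> x)\<^sup>2)" "x \<bullet> x = (\<Sum>i\<in>UNIV. (v i \<bullet> x)\<^sup>2)"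
proof -
  show "x \<bullet> (V *v x) = (\<Sum>i\<in>UNIV. g i * (v i \<bullet> x)\<^sup>2)"
    by (simp add: spectral_decomp_mult[OF assms] inner_sum_right inner_commute[of x "v _"] power2_eq_square mult.assoc)
  have "x \<bullet> x = x \<bullet> (\<Sum>i\<in>UNIV. (v i \<bullet> x) *\<^sub>R v i)"
    using assms by (simp add: orthonormal_family_expand spectral_decomp_def)
  also have "\<dots> = (\<Sum>i\<in>UNIV. (v i \<bullet> x)\<^sup>2)"
    by (simp add: inner_sum_right inner_commute[of x "v _"] power2_eq_square)
  finally show "x \<bullet> x = (\<Sum>i\<in>UNIV. (v i \<bullet> x)\<^sup>2)" .
qed

lemma gamma_spectral_decomp:
  assumes "spectral_decomp V g v"
  shows "gamma_min V = Min (range g)" "gamma_max V = Max (range g)"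
  by (simp_all add: gamma_min_def gamma_max_def spectral_decomp_eigenvalues[OF assms])

text \<open>The Courant-Fischer description of the smallest eigenvalue. The right-hand side is an
  intersection of closed conditions on \<open>V\<close>, which gives measurability.\<close>

lemma gamma_min_ge_iff:
  fixes V :: "real^'n^'n"
  assumes "transpose V = V"
  shows "c \<le> gamma_min V \<longleftrightarrow> (\<forall>x. c * (x \<bullet> x) \<le> x \<bullet> (V *v x))"
proof -
  obtain g v where d: "spectral_decomp V g v" using spectral_decomp_exists[OF assms] .
  have on: "v i \<bullet> v i = 1" for i using d by (simp add: spectral_decomp_def)
  show ?thesis
  proof
    assume "c \<le> gamma_min V"
    then have "c \<le> g i" for i by (simp add: gamma_spectral_decomp[OF d])
    then show "\<forall>x. c * (x \<bullet> x) \<le> x \<bullet> (V *v x)"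
      by (auto simp: spectral_decomp_quadratic_form[OF d] sum_distrib_left intro!: sum_mono mult_right_mono)
  next
    assume *: "\<forall>x. c * (x \<bullet> x) \<le> x \<bullet> (V *v x)"
    have "c \<le> g i" for i using *[rule_format, of "v i"] by (simp add: spectral_decomp_eigen[OF d] on)
    then show "c \<le> gamma_min V" by (simp add: gamma_spectral_decomp[OF d])
  qed
qed

lemma gamma_max_le_iff:
  fixes V :: "real^'n^'n"
  assumes "transpose V = V"
  shows "gamma_max V \<le> c \<longleftrightarrow> (\<forall>x. x \<bullet> (V *v x) \<le> c * (x \<bullet> x))"
proof -
  obtain g v where d: "spectral_decomp V g v" using spectral_decomp_exists[OF assms] .
  have on: "v i \<bullet> v i = 1" for i using d by (simp add: spectral_decomp_def)
  show ?thesis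
  proof
    assume "gamma_max V \<le> c"
    then have "g i \<le> c" for i by (simp add: gamma_spectral_decomp[OF d])
    then show "\<forall>x. x \<bullet> (V *v x) \<le> c * (x \<bullet> x)"
      by (auto simp: spectral_decomp_quadratic_form[OF d] sum_distrib_left intro!: sum_mono mult_right_mono)
  next
    assume *: "\<forall>x. x \<bullet> (V *v x) \<le> c * (x \<bullet> x)"
    have "g i \<le> c" for i using *[rule_format, of "v i"] by (simp add: spectral_decomp_eigen[OF d] on)
    then show "gamma_max V \<le> c" by (simp add: gamma_spectral_decomp[OF d])
  qed
qed

lemma gamma_min_le_gamma_max:
  fixes V :: "real^'n^'n"
  assumes "transpose V = V"
  shows "gamma_min V \<le> gamma_max V"
proof -
  obtain g v where d: "spectral_decomp V g v" using spectral_decomp_exists[OF assms] .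
  have "Min (range g) \<le> g undefined" "g undefined \<le> Max (range g)" by (auto intro: Min_le Max_ge)
  then show ?thesis by (simp add: gamma_spectral_decomp[OF d])
qed

lemma gamma_mat_max:
  fixes V :: "real^'n^'n"
  assumes "transpose V = V"
  shows "gamma_min (mat_max V \<rho>) = max (gamma_min V) \<rho>"
    "gamma_max (mat_max V \<rho>) = max (gamma_max V) \<rho>"
proof -
  obtain g v where d: "spectral_decomp V g v" using spectral_decomp_exists[OF assms] .
  have m: "mono (\<lambda>x::real. max x \<rho>)" by (rule monoI) auto
  have "range (\<lambda>i. max (g i) \<rho>) = (\<lambda>x. max x \<rho>) ` range g" by auto
  then show "gamma_min (mat_max V \<rho>) = max (gamma_min V) \<rho>"
    "gamma_max (mat_max V \<rho>) = max (gamma_max V) \<rho>"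
    unfolding mat_max_def gamma_spectral_decomp[OF spectral_decomp_fun[OF d]] gamma_spectral_decomp[OF d]
    using mono_Min_commute[OF m, of "range g"] mono_Max_commute[OF m, of "range g"] by auto
qed

lemma mat_max_symmetric: "transpose V = V \<Longrightarrow> transpose (mat_max V \<rho>) = mat_max V \<rho>"
  by (simp add: mat_max_def spectral_fun_symmetric)

lemma quadratic_form_le_mat_max:
  assumes "transpose V = V"
  shows "x \<bullet> (V *v x) \<le> x \<bullet> (mat_max V \<rho> *v x)"
proof -
  obtain g v where d: "spectral_decomp V g v" using spectral_decomp_exists[OF assms] .
  show ?thesis
    unfolding mat_max_def spectral_decomp_quadratic_form(1)[OF d]
      spectral_decomp_quadratic_form(1)[OF spectral_decomp_fun[OF d]]
    by (intro sum_mono mult_right_mono) auto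
qed

lemma one_le_cond_number:
  assumes "transpose W = W" "0 < gamma_min W"
  shows "1 \<le> cond_number W"
  using gamma_min_le_gamma_max[OF assms(1)] assms(2) by (simp add: cond_number_def)

section \<open>Measurability of spectral quantities\<close>

lemma borel_measurable_matrix_vector_mult [measurable]:
  fixes A :: "'a \<Rightarrow> real^'n^'m"
  assumes [measurable]: "A \<in> borel_measurable N" "x \<in> borel_measurable N"
  shows "(\<lambda>\<omega>. A \<omega> *v x \<omega>) \<in> borel_measurable N"
proof -
  have "(\<lambda>(A, x :: real^'n). (A :: real^'n^'m) *v x) \<in> borel_measurable (borel \<Otimes>\<^sub>M borel)"
    unfolding borel_prod
    by (intro borel_measurable_continuous_onI)
       (auto simp: matrix_vector_mult_def split_beta intro!: continuous_intros)
  then have "(\<lambda>\<omega>. (\<lambda>(A, x). A *v x) (A \<omega>, x \<omega>)) \<in> borel_measurable N" by measurable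
  then show ?thesis by simp
qed

text \<open>By Weierstrass there are polynomials that converge to \<open>f\<close> pointwise on the real
  line, the one with index \<open>m\<close> being close to \<open>f\<close> on \<open>[-m,
  m]\<close>. Applied to a symmetric matrix they are polynomials in its entries, and they
  converge on each of its eigenvalues, hence so do the matrices applied to a vector.\<close>

lemma borel_measurable_spectral_fun_mult:
  fixes A :: "'a \<Rightarrow> real^'n^'n"
  assumes [measurable]: "A \<in> borel_measurable N" "x \<in> borel_measurable N"
    and sym: "\<And>\<omega>. \<omega> \<in> space N \<Longrightarrow> transpose (A \<omega>) = A \<omega>"
    and f: "continuous_on UNIV f"
  shows "(\<lambda>\<omega>. spectral_fun f (A \<omega>) *v x \<omega>) \<in> borel_measurable N"
proof -
  have "\<exists>a n. \<forall>y\<in>{- real m..real m}. \<bar>f y - (\<Sum>i\<le>n. a i * y ^ i)\<bar> < 1 / real (Suc m)" for m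
  proof -
    obtain p where p: "real_polynomial_function p"
        "\<And>y. y \<in> {- real m..real m} \<Longrightarrow> \<bar>f y - p y\<bar> < 1 / real (Suc m)"
      using Stone_Weierstrass_real_polynomial_function[of "{- real m..real m}" f "1 / real (Suc m)"]
        continuous_on_subset[OF f] by auto
    with real_polynomial_function_iff_sum[of p] show ?thesis by fastforce
  qed
  then obtain a n where an: "\<And>m y. y \<in> {- real m..real m} \<Longrightarrow>
      \<bar>f y - (\<Sum>i\<le>n m. a m i * y ^ i)\<bar> < 1 / real (Suc m)" by metis
  have lim: "(\<lambda>m. \<Sum>i\<le>n m. a m i * y ^ i) \<longlonglongrightarrow> f y" for y
  proof (rule LIM_zero_cancel, rule Lim_null_comparison[OF _ LIMSEQ_inverse_real_of_nat])
    show "\<forall>\<^sub>F m in sequentially. norm ((\<Sum>i\<le>n m. a m i * y ^ i) - f y) \<le> inverse (real (Suc m))"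
      using eventually_ge_at_top[of "nat \<lceil>\<bar>y\<bar>\<rceil>"]
    proof eventually_elim
      case (elim m)
      then have "\<bar>y\<bar> \<le> real m" by linarith
      then show ?case using an[of y m] by (auto simp: abs_minus_commute inverse_eq_divide abs_le_iff)
    qed
  qed
  define P where "P = (\<lambda>m \<omega>. \<Sum>i\<le>n m. a m i *\<^sub>R ((*v) (A \<omega>) ^^ i) (x \<omega>))"
  have [measurable]: "(\<lambda>\<omega>. ((*v) (A \<omega>) ^^ i) (x \<omega>)) \<in> borel_measurable N" for i
    by (induction i) simp_all
  show ?thesis
  proof (rule borel_measurable_LIMSEQ_metric)
    show "P m \<in> borel_measurable N" for m unfolding P_def by simp
    fix \<omega> assume \<omega>: "\<omega> \<in> space N"
    obtain g v where d: "spectral_decomp (A \<omega>) g v" using spectral_decomp_exists[OF sym[OF \<omega>]] .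
    have pow: "((*v) (A \<omega>) ^^ i) (x \<omega>) = (\<Sum>j\<in>UNIV. (g j ^ i * (v j \<bullet> x \<omega>)) *\<^sub>R v j)" for i
    proof (induction i)
      case 0
      then show ?case using d by (simp add: orthonormal_family_expand spectral_decomp_def)
    next
      case (Suc i)
      have vj: "v j \<bullet> ((*v) (A \<omega>) ^^ i) (x \<omega>) = g j ^ i * (v j \<bullet> x \<omega>)" for j
        using d unfolding Suc by (simp add: spectral_decomp_def inner_sum_right if_distrib[of "\<lambda>z. _ * z"] cong: if_cong)
      have "((*v) (A \<omega>) ^^ Suc i) (x \<omega>) = A \<omega> *v (((*v) (A \<omega>) ^^ i) (x \<omega>))" by simp
      also have "\<dots> = (\<Sum>j\<in>UNIV. (g j ^ Suc i * (v j \<bullet> x \<omega>)) *\<^sub>R v j)"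
        unfolding spectral_decomp_mult[OF d, of "((*v) (A \<omega>) ^^ i) (x \<omega>)"] vj
        by (simp only: power_Suc mult.assoc)
      finally show ?case .
    qed
    have "P m \<omega> = (\<Sum>j\<in>UNIV. ((\<Sum>i\<le>n m. a m i * g j ^ i) * (v j \<bullet> x \<omega>)) *\<^sub>R v j)" for m
      unfolding P_def pow
      by (simp add: scaleR_sum_right sum_distrib_right scaleR_sum_left mult.assoc)
         (rule sum.swap)
    then show "(\<lambda>m. P m \<omega>) \<longlonglongrightarrow> spectral_fun f (A \<omega>) *v x \<omega>"
      unfolding spectral_decomp_fun_mult[OF d] by (auto intro!: tendsto_intros lim)
  qed
qed

lemma borel_measurable_gamma_min:
  fixes A :: "'a \<Rightarrow> real^'n^'n"
  assumes [measurable]: "A \<in> borel_measurable N"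
    and sym: "\<And>\<omega>. \<omega> \<in> space N \<Longrightarrow> transpose (A \<omega>) = A \<omega>"
  shows "(\<lambda>\<omega>. gamma_min (A \<omega>)) \<in> borel_measurable N"
proof (rule borel_measurable_iff_ge[THEN iffD2], rule allI)
  fix c
  have "closed (\<Inter>x::real^'n. {B :: real^'n^'n. c * (x \<bullet> x) \<le> x \<bullet> (B *v x)})"
    by (intro closed_INT ballI closed_Collect_le)
       (auto simp: matrix_vector_mult_def inner_vec_def intro!: continuous_intros)
  then have [measurable]: "(\<Inter>x::real^'n. {B :: real^'n^'n. c * (x \<bullet> x) \<le> x \<bullet> (B *v x)}) \<in> sets borel"
    by (rule borel_closed)
  have "{\<omega> \<in> space N. c \<le> gamma_min (A \<omega>)} =
      {\<omega> \<in> space N. A \<omega> \<in> (\<Inter>x::real^'n. {B. c * (x \<bullet> x) \<le> x \<bullet> (B *v x)})}"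
    using gamma_min_ge_iff[OF sym] by auto
  also have "\<dots> \<in> sets N" by measurable
  finally show "{\<omega> \<in> space N. c \<le> gamma_min (A \<omega>)} \<in> sets N" .
qed

lemma borel_measurable_gamma_max:
  fixes A :: "'a \<Rightarrow> real^'n^'n"
  assumes [measurable]: "A \<in> borel_measurable N"
    and sym: "\<And>\<omega>. \<omega> \<in> space N \<Longrightarrow> transpose (A \<omega>) = A \<omega>"
  shows "(\<lambda>\<omega>. gamma_max (A \<omega>)) \<in> borel_measurable N"
proof (rule borel_measurable_iff_le[THEN iffD2], rule allI)
  fix c
  have "closed (\<Inter>x::real^'n. {B :: real^'n^'n. x \<bullet> (B *v x) \<le> c * (x \<bullet> x)})"
    by (intro closed_INT ballI closed_Collect_le)
       (auto simp: matrix_vector_mult_def inner_vec_def intro!: continuous_intros)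
  then have [measurable]: "(\<Inter>x::real^'n. {B :: real^'n^'n. x \<bullet> (B *v x) \<le> c * (x \<bullet> x)}) \<in> sets borel"
    by (rule borel_closed)
  have "{\<omega> \<in> space N. gamma_max (A \<omega>) \<le> c} =
      {\<omega> \<in> space N. A \<omega> \<in> (\<Inter>x::real^'n. {B. x \<bullet> (B *v x) \<le> c * (x \<bullet> x)})}"
    using gamma_max_le_iff[OF sym] by auto
  also have "\<dots> \<in> sets N" by measurable
  finally show "{\<omega> \<in> space N. gamma_max (A \<omega>) \<le> c} \<in> sets N" .
qed

text \<open>Used for \<open>h\<close>, for the covering number and for \<open>psi_E_conj_inv\<close>,
  which are monotone on a half-line and need not be continuous.\<close>

lemma borel_measurable_mono_on_comp:
  fixes f :: "'a \<Rightarrow> real" and g :: "real \<Rightarrow> real"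
  assumes g: "mono_on {c..} g" and [measurable]: "f \<in> borel_measurable N"
    and f: "\<And>\<omega>. \<omega> \<in> space N \<Longrightarrow> c \<le> f \<omega>"
  shows "(\<lambda>\<omega>. g (f \<omega>)) \<in> borel_measurable N"
proof -
  have "mono (\<lambda>x. g (max x c))" by (intro monoI mono_onD[OF g]) auto
  then have [measurable]: "(\<lambda>x. g (max x c)) \<in> borel_measurable borel" by (rule borel_measurable_mono)
  have "(\<lambda>\<omega>. (\<lambda>x. g (max x c)) (f \<omega>)) \<in> borel_measurable N" by measurable
  then show ?thesis by (rule measurable_cong[THEN iffD1, rotated]) (simp add: f max_absorb1)
qed

section \<open>Covering numbers of compact sets\<close>

text \<open>Without compactness \<open>covering_number\<close> is the \<open>LEAST\<close> element of a
  possibly empty set and carries no information; total boundedness makes it the size of an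
  actual cover.\<close>

lemma covering_number_attained:
  fixes S :: "'a::real_normed_vector set"
  assumes "compact S" "0 < \<epsilon>"
  shows "\<exists>K. finite K \<and> card K = covering_number S \<epsilon> \<and> K \<subseteq> S \<and> (\<forall>x\<in>S. \<exists>y\<in>K. norm (x - y) \<le> \<epsilon>)"
proof -
  let ?P = "\<lambda>n. \<exists>K. finite K \<and> card K = n \<and> K \<subseteq> S \<and> (\<forall>x\<in>S. \<exists>y\<in>K. norm (x - y) \<le> \<epsilon>)"
  obtain K where K: "finite K" "K \<subseteq> S" "S \<subseteq> (\<Union>x\<in>K. ball x \<epsilon>)"
    using seq_compact_imp_totally_bounded[of S] assms compact_eq_seq_compact_metric by metis
  have "\<forall>x\<in>S. \<exists>y\<in>K. norm (x - y) \<le> \<epsilon>"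
  proof
    fix x assume "x \<in> S"
    then obtain y where "y \<in> K" "dist y x < \<epsilon>" using K(3) by auto
    then show "\<exists>y\<in>K. norm (x - y) \<le> \<epsilon>"
      by (intro bexI[of _ y]) (simp_all add: dist_norm norm_minus_commute)
  qed
  with K have "?P (card K)" by blast
  then have "?P (LEAST n. ?P n)" by (rule LeastI)
  then show ?thesis unfolding covering_number_def .
qed

lemma covering_number_antimono:
  fixes S :: "'a::real_normed_vector set"
  assumes "compact S" "0 < \<epsilon>" "\<epsilon> \<le> \<epsilon>'"
  shows "covering_number S \<epsilon>' \<le> covering_number S \<epsilon>"
proof -
  obtain K where K: "finite K" "card K = covering_number S \<epsilon>" "K \<subseteq> S"
    "\<forall>x\<in>S. \<exists>y\<in>K. norm (x - y) \<le> \<epsilon>"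
    using covering_number_attained[OF assms(1,2)] by blast
  have "\<forall>x\<in>S. \<exists>y\<in>K. norm (x - y) \<le> \<epsilon>'" using K(4) assms(3) by (meson order_trans)
  then show ?thesis
    unfolding covering_number_def[of S \<epsilon>'] using K(1-3) by (intro Least_le) blast
qed

lemma covering_number_pos:
  fixes S :: "'a::real_normed_vector set"
  assumes "compact S" "S \<noteq> {}" "0 < \<epsilon>"
  shows "0 < covering_number S \<epsilon>"
proof -
  obtain K where K: "finite K" "card K = covering_number S \<epsilon>" "K \<subseteq> S"
    "\<forall>x\<in>S. \<exists>y\<in>K. norm (x - y) \<le> \<epsilon>"
    using covering_number_attained[OF assms(1,3)] by blast
  obtain x where "x \<in> S" using assms(2) by blast
  then have "K \<noteq> {}" using K(4) by auto
  then have "0 < card K" using K(1) by (simp add: card_gt_0_iff)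
  then show ?thesis using K(2) by simp
qed

section \<open>Supermartingales and line crossing\<close>

lemma subalgebra_filtration_mono:
  assumes "filtration \<Omega> F" "s \<le> t"
  shows "subalgebra (F t) (F s)"
  using assms by (simp add: subalgebra_def filtration.space_F filtration.sets_F_mono)

lemma supermartingale_set_integral_decreasing:
  assumes "prob_space M" "\<And>t. subalgebra M (F t)" "supermartingale M F L"
    and "A \<in> sets (F t)"
  shows "(LINT \<omega>:A|M. L (Suc t) \<omega>) \<le> (LINT \<omega>:A|M. L t \<omega>)"
proof -
  interpret prob_space M by fact
  interpret sigma_finite_subalgebra M "F t"
    using assms(2) by (intro finite_measure_subalgebra_is_sigma_finite)
      (simp add: finite_measure_subalgebra_def finite_measure_subalgebra_axioms_def finite_measure_axioms)
  have int: "integrable M (L s)" for s using assms(3) by (simp add: supermartingale_def)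
  have "A \<in> sets M" using assms(2)[of t] assms(4) by (auto simp: subalgebra_def)
  then have sint: "set_integrable M A f" if "integrable M f" for f :: "'a \<Rightarrow> real"
    using integrable_mult_indicator[of A M f] that by (simp add: set_integrable_def)
  have "(LINT \<omega>:A|M. L (Suc t) \<omega>) = (LINT \<omega>:A|M. real_cond_exp M (F t) (L (Suc t)) \<omega>)"
    by (rule real_cond_exp_intA[OF int assms(4)])
  also have "\<dots> \<le> (LINT \<omega>:A|M. L t \<omega>)"
  proof (intro set_integral_mono_AE sint int real_cond_exp_int(1))
    have "AE \<omega> in M. real_cond_exp M (F t) (L (Suc t)) \<omega> \<le> L t \<omega>"
      using assms(3) by (simp add: supermartingale_def)
    then show "AE \<omega>\<in>A in M. real_cond_exp M (F t) (L (Suc t)) \<omega> \<le> L t \<omega>"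
      by eventually_elim simp
  qed
  finally show ?thesis .
qed

text \<open>The stopped process is replaced by a budget: the mass still carried by \<open>L\<close> on
  the paths that have not yet reached \<open>c\<close>, plus \<open>c\<close> times the
  probability of having reached it, never exceeds its initial value, which is at most one.\<close>

lemma ville_inequality:
  assumes "prob_space M" and filt: "filtration (space M) F" and sub: "\<And>t. subalgebra M (F t)"
    and L: "supermartingale M F L"
    and nonneg: "\<And>t \<omega>. \<omega> \<in> space M \<Longrightarrow> 0 \<le> L t \<omega>"
    and init: "integral\<^sup>L M (L 0) \<le> 1" and c: "0 < c"
  shows "{\<omega> \<in> space M. \<exists>t. c \<le> L t \<omega>} \<in> sets M"
    "measure M {\<omega> \<in> space M. \<exists>t. c \<le> L t \<omega>} \<le> 1 / c"
proof -
  interpret prob_space M by fact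
  have int: "integrable M (L t)" for t using L by (simp add: supermartingale_def)
  then have [measurable]: "L t \<in> borel_measurable M" for t by auto
  \<comment> \<open>\<open>N t\<close> is the event that \<open>L\<close> has stayed below \<open>c\<close> strictly before time \<open>t\<close>.\<close>
  define N where "N = (\<lambda>t. {\<omega> \<in> space M. \<forall>s<t. L s \<omega> < c})"
  have N_F: "N (Suc t) \<in> sets (F t)" for t
  proof -
    have L_F: "L s \<in> borel_measurable (F t)" if "s < Suc t" for s
      using that L
      by (intro measurable_from_subalg[OF subalgebra_filtration_mono[OF filt, of s t]])
         (simp_all add: supermartingale_def adapted_to_def)
    have "{\<omega> \<in> space (F t). \<forall>s\<in>{..<Suc t}. L s \<omega> < c} \<in> sets (F t)"
      using L_F by (intro sets.sets_Collect_finite_All borel_measurable_less) simp_all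
    then show ?thesis by (simp only: N_def filtration.space_F[OF filt] Ball_def lessThan_iff)
  qed
  have [measurable]: "N t \<in> sets M" for t unfolding N_def by measurable
  have sint: "set_integrable M A (L t)" if "A \<in> sets M" for A t
    using integrable_mult_indicator[OF that int[of t]] by (simp add: set_integrable_def)
  have budget: "(LINT \<omega>:N t|M. L t \<omega>) + c * measure M (space M - N t) \<le> 1" for t
  proof (induction t)
    case 0
    have "N 0 = space M" by (simp add: N_def)
    then show ?case using init by (simp add: set_integral_space int)
  next
    case (Suc t)
    let ?H = "N t - N (Suc t)"
    have NS: "N (Suc t) \<subseteq> N t" by (auto simp: N_def)
    have "c * measure M ?H = (LINT \<omega>:?H|M. c)"
      by (simp add: set_integral_const emeasure_eq_measure)
    also have "\<dots> \<le> (LINT \<omega>:?H|M. L t \<omega>)"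
    proof (intro set_integral_mono sint)
      show "set_integrable M ?H (\<lambda>_. c)"
        using integrable_mult_indicator[of ?H M "\<lambda>_. c"] by (simp add: set_integrable_def)
    qed (auto simp: N_def less_Suc_eq)
    finally have hit: "c * measure M ?H \<le> (LINT \<omega>:?H|M. L t \<omega>)" .
    have "(LINT \<omega>:N t|M. L t \<omega>) = (LINT \<omega>:?H \<union> N (Suc t)|M. L t \<omega>)"
      using NS by (simp add: Un_absorb2)
    also have "\<dots> = (LINT \<omega>:?H|M. L t \<omega>) + (LINT \<omega>:N (Suc t)|M. L t \<omega>)"
      by (intro set_integral_Un sint) auto
    finally have split: "(LINT \<omega>:N t|M. L t \<omega>) = (LINT \<omega>:?H|M. L t \<omega>) + (LINT \<omega>:N (Suc t)|M. L t \<omega>)" .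
    have "measure M (space M - N (Suc t)) = measure M ((space M - N t) \<union> ?H)"
      using NS by (intro arg_cong[where f = "measure M"]) (auto simp: N_def)
    also have "\<dots> = measure M (space M - N t) + measure M ?H"
      by (intro finite_measure_Union) auto
    finally have "c * measure M (space M - N (Suc t)) = c * measure M (space M - N t) + c * measure M ?H"
      by (simp add: distrib_left)
    then show ?case
      using Suc hit split supermartingale_set_integral_decreasing[OF assms(1) sub L N_F, of t] by linarith
  qed
  have "measure M (space M - N t) \<le> 1 / c" for t
  proof -
    have "0 \<le> (LINT \<omega>:N t|M. L t \<omega>)"
      unfolding set_lebesgue_integral_def
      by (intro Bochner_Integration.integral_nonneg_AE AE_I2) (simp add: nonneg)
    then have "c * measure M (space M - N t) \<le> 1" using budget[of t] by simp
    then show ?thesis using c by (simp add: field_simps)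
  qed
  moreover have "(\<lambda>t. measure M (space M - N t)) \<longlonglongrightarrow> measure M (\<Union>t. space M - N t)"
    by (intro finite_Lim_measure_incseq) (auto simp: incseq_def N_def)
  ultimately have "measure M (\<Union>t. space M - N t) \<le> 1 / c" by (intro LIMSEQ_le_const2) auto
  moreover have "(\<Union>t. space M - N t) = {\<omega> \<in> space M. \<exists>t. c \<le> L t \<omega>}"
    unfolding N_def by (auto simp: not_less) (metis lessI not_le)
  ultimately show "measure M {\<omega> \<in> space M. \<exists>t. c \<le> L t \<omega>} \<le> 1 / c" by simp
  show "{\<omega> \<in> space M. \<exists>t. c \<le> L t \<omega>} \<in> sets M" by measurable
qed

lemma supermartingaleI_one_step:
  assumes "prob_space M" and filt: "filtration (space M) F" and sub: "\<And>t. subalgebra M (F t)"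
    and adapted: "adapted_to F L" and int: "\<And>t. integrable M (L t)"
    and step: "\<And>t. AE \<omega> in M. real_cond_exp M (F t) (L (Suc t)) \<omega> \<le> L t \<omega>"
  shows "supermartingale M F L"
  unfolding supermartingale_def
proof (intro conjI allI impI)
  interpret prob_space M by fact
  have sf: "sigma_finite_subalgebra M (F t)" for t
    using sub by (intro finite_measure_subalgebra_is_sigma_finite)
      (simp add: finite_measure_subalgebra_def finite_measure_subalgebra_axioms_def finite_measure_axioms)
  fix s t :: nat assume "s \<le> t"
  then show "AE \<omega> in M. real_cond_exp M (F s) (L t) \<omega> \<le> L s \<omega>"
  proof (induction t rule: dec_induct)
    case base
    have "AE \<omega> in M. real_cond_exp M (F s) (L s) \<omega> = L s \<omega>"
      using adapted int by (intro sigma_finite_subalgebra.real_cond_exp_F_meas[OF sf]) (simp_all add: adapted_to_def)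
    then show ?case by (rule AE_mp) simp
  next
    case (step t)
    have "AE \<omega> in M. real_cond_exp M (F s) (real_cond_exp M (F t) (L (Suc t))) \<omega>
        = real_cond_exp M (F s) (L (Suc t)) \<omega>"
      using step by (intro sigma_finite_subalgebra.real_cond_exp_nested_subalg sf sub int
          subalgebra_filtration_mono[OF filt]) auto
    moreover have "AE \<omega> in M. real_cond_exp M (F s) (real_cond_exp M (F t) (L (Suc t))) \<omega>
        \<le> real_cond_exp M (F s) (L t) \<omega>"
      by (intro sigma_finite_subalgebra.real_cond_exp_mono sf assms(6) int
          sigma_finite_subalgebra.real_cond_exp_int(1))
    ultimately show ?case using step.IH by eventually_elim linarith
  qed
qed (use adapted int in auto)

text \<open>Ville's inequality at level \<open>exp b\<close> for the dominating supermartingale. The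
  crossing may be attained with equality, since Ville's inequality is stated for \<open>c
  \<le> L t\<close>.\<close>

lemma sub_psi_line_crossing:
  assumes "prob_space M" "filtration (space M) F" "\<And>t. subalgebra M (F t)"
    and sub: "sub_psi M F lmax \<psi> S V"
    and \<nu>: "norm \<nu> = 1" and l: "0 \<le> l" "ereal l < lmax"
  shows "{\<omega> \<in> space M. \<exists>t. b \<le> l * (\<nu> \<bullet> S t \<omega>) - \<psi> l * (\<nu> \<bullet> (V t \<omega> *v \<nu>))} \<in> sets M"
    "measure M {\<omega> \<in> space M. \<exists>t. b \<le> l * (\<nu> \<bullet> S t \<omega>) - \<psi> l * (\<nu> \<bullet> (V t \<omega> *v \<nu>))} \<le> exp (- b)"
proof -
  interpret prob_space M by fact
  have [measurable]: "S t \<in> borel_measurable M" "V t \<in> borel_measurable M" for t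
    by (rule measurable_from_subalg[OF assms(3)[of t]], use sub in \<open>simp add: sub_psi_def adapted_to_def\<close>)+
  show sets: "{\<omega> \<in> space M. \<exists>t. b \<le> l * (\<nu> \<bullet> S t \<omega>) - \<psi> l * (\<nu> \<bullet> (V t \<omega> *v \<nu>))} \<in> sets M"
    by measurable
  obtain L where L: "supermartingale M F L" "\<And>t \<omega>. \<omega> \<in> space M \<Longrightarrow> 0 \<le> L t \<omega>" "integral\<^sup>L M (L 0) \<le> 1"
      "AE \<omega> in M. \<forall>t. exp (l * (\<nu> \<bullet> S t \<omega>) - \<psi> l * (\<nu> \<bullet> (V t \<omega> *v \<nu>))) \<le> L t \<omega>"
  proof -
    have "\<nu> \<in> sphere 0 1" using \<nu> by simp
    with sub l have "\<exists>L. supermartingale M F L \<and> (\<forall>t. \<forall>\<omega>\<in>space M. 0 \<le> L t \<omega>) \<and>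
        integral\<^sup>L M (L 0) \<le> 1 \<and>
        (AE \<omega> in M. \<forall>t. exp (l * (\<nu> \<bullet> S t \<omega>) - \<psi> l * (\<nu> \<bullet> (V t \<omega> *v \<nu>))) \<le> L t \<omega>)"
      by (simp only: sub_psi_def)
    then show ?thesis using that by blast
  qed
  note ville = ville_inequality[OF assms(1-3) L(1-3), of "exp b"]
  have "measure M {\<omega> \<in> space M. \<exists>t. b \<le> l * (\<nu> \<bullet> S t \<omega>) - \<psi> l * (\<nu> \<bullet> (V t \<omega> *v \<nu>))}
      \<le> measure M {\<omega> \<in> space M. \<exists>t. exp b \<le> L t \<omega>}"
  proof (rule finite_measure_mono_AE)
    show "AE \<omega> in M. \<omega> \<in> {\<omega> \<in> space M. \<exists>t. b \<le> l * (\<nu> \<bullet> S t \<omega>) - \<psi> l * (\<nu> \<bullet> (V t \<omega> *v \<nu>))}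
        \<longrightarrow> \<omega> \<in> {\<omega> \<in> space M. \<exists>t. exp b \<le> L t \<omega>}"
      using L(4) by eventually_elim (auto intro: order_trans[OF exp_le_cancel_iff[THEN iffD2]])
  qed (use ville(1) in simp)
  also have "\<dots> \<le> exp (- b)" using ville(2) by (simp add: exp_minus inverse_eq_divide)
  finally show "measure M {\<omega> \<in> space M. \<exists>t. b \<le> l * (\<nu> \<bullet> S t \<omega>) - \<psi> l * (\<nu> \<bullet> (V t \<omega> *v \<nu>))} \<le> exp (- b)" .
qed

section \<open>The exponential supermartingale of a bounded process\<close>

lemma borel_measurable_vec_componentwise:
  fixes f :: "'a \<Rightarrow> 'b::euclidean_space ^ 'n"
  assumes "\<And>i. (\<lambda>\<omega>. f \<omega> $ i) \<in> borel_measurable N"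
  shows "f \<in> borel_measurable N"
proof (rule borel_measurable_euclidean_space[THEN iffD2], rule ballI)
  fix b :: "'b ^ 'n" assume "b \<in> Basis"
  then obtain i u where "b = axis i u" by (auto simp: Basis_vec_def)
  then show "(\<lambda>\<omega>. f \<omega> \<bullet> b) \<in> borel_measurable N"
    using assms by (simp add: inner_axis)
qed

lemma borel_measurable_vec_nth [measurable (raw)]:
  fixes f :: "'a \<Rightarrow> real^'n"
  assumes [measurable]: "f \<in> borel_measurable N"
  shows "(\<lambda>\<omega>. f \<omega> $ i) \<in> borel_measurable N"
proof -
  have "(\<lambda>\<omega>. f \<omega> \<bullet> axis i 1) \<in> borel_measurable N" by measurable
  then show ?thesis by (simp add: inner_axis)
qed

lemma borel_measurable_outer_prod:
  fixes f g :: "'a \<Rightarrow> real^'n"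
  assumes [measurable]: "f \<in> borel_measurable N" "g \<in> borel_measurable N"
  shows "(\<lambda>\<omega>. outer_prod (f \<omega>) (g \<omega>)) \<in> borel_measurable N"
  by (intro borel_measurable_vec_componentwise) (simp add: outer_prod_def)

lemma borel_measurable_vec_cond_exp: "vec_cond_exp M G Y \<in> borel_measurable G"
  by (intro borel_measurable_vec_componentwise) (simp add: vec_cond_exp_def)

text \<open>The conditional expectation of a vector is defined by components, so this is the linearity
  of the scalar conditional expectation, which holds up to a null set.\<close>

lemma inner_vec_cond_exp:
  assumes "sigma_finite_subalgebra M G" and "\<And>i. integrable M (\<lambda>\<omega>. Y \<omega> $ i)"
  shows "AE \<omega> in M. \<nu> \<bullet> vec_cond_exp M G Y \<omega> = real_cond_exp M G (\<lambda>\<omega>. \<nu> \<bullet> Y \<omega>) \<omega>"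
proof -
  interpret sigma_finite_subalgebra M G by fact
  have "AE \<omega> in M. \<forall>i\<in>UNIV. real_cond_exp M G (\<lambda>\<omega>. \<nu> $ i * Y \<omega> $ i) \<omega>
      = \<nu> $ i * real_cond_exp M G (\<lambda>\<omega>. Y \<omega> $ i) \<omega>"
    by (intro AE_finite_allI real_cond_exp_cmult assms(2)) simp
  moreover have "AE \<omega> in M. real_cond_exp M G (\<lambda>\<omega>. \<Sum>i\<in>UNIV. \<nu> $ i * Y \<omega> $ i) \<omega>
      = (\<Sum>i\<in>UNIV. real_cond_exp M G (\<lambda>\<omega>. \<nu> $ i * Y \<omega> $ i) \<omega>)"
    using assms(2) by (intro real_cond_exp_sum) simp
  ultimately show ?thesis
    by eventually_elim (simp add: vec_cond_exp_def inner_vec_def)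
qed

lemma V_proc_quadratic_form:
  "\<nu> \<bullet> (V_proc X t \<omega> *v \<nu>) = (\<Sum>s=1..t. (\<nu> \<bullet> (X s \<omega> - emp_mean X (s - 1) \<omega>))\<^sup>2)"
  using sum_outer_prod_mult[of "\<lambda>_. 1" "\<lambda>s. X s \<omega> - emp_mean X (s - 1) \<omega>"
      "\<lambda>s. X s \<omega> - emp_mean X (s - 1) \<omega>" "{1..t}" \<nu>]
  by (simp add: V_proc_def inner_sum_right power2_eq_square inner_commute[of \<nu>])

lemma psd_V_proc: "psd (V_proc X t \<omega>)"
proof -
  have "transpose (V_proc X t \<omega>) = V_proc X t \<omega>"
    by (simp add: V_proc_def transpose_def vec_eq_iff outer_prod_def mult.commute)
  then show ?thesis unfolding psd_def V_proc_quadratic_form by (simp add: sum_nonneg)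
qed

lemma abs_inner_unit_le:
  fixes \<nu> x :: "'a::real_inner"
  shows "norm \<nu> = 1 \<Longrightarrow> norm x \<le> b \<Longrightarrow> \<bar>\<nu> \<bullet> x\<bar> \<le> b"
  using Cauchy_Schwarz_ineq2[of \<nu> x] by simp

locale bounded_adapted_process = prob_space M + filtration "space M" F
  for M :: "'a measure" and F :: "nat \<Rightarrow> 'a measure" +
  fixes X :: "nat \<Rightarrow> 'a \<Rightarrow> real^'n"
  assumes subalg: "\<And>t. subalgebra M (F t)"
    and X_adapted: "\<And>t. t \<ge> 1 \<Longrightarrow> X t \<in> borel_measurable (F t)"
    and X_bounded: "\<And>t. t \<ge> 1 \<Longrightarrow> (AE \<omega> in M. norm (X t \<omega>) \<le> 1 / 2)"
begin

lemma sigma_finite_F: "sigma_finite_subalgebra M (F t)"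
  using subalg by (intro finite_measure_subalgebra_is_sigma_finite)
    (simp add: finite_measure_subalgebra_def finite_measure_subalgebra_axioms_def finite_measure_axioms)

lemma measurable_F_mono: "f \<in> borel_measurable (F s) \<Longrightarrow> s \<le> t \<Longrightarrow> f \<in> borel_measurable (F t)"
  by (rule measurable_from_subalg[OF subalgebra_filtration_mono[OF filtration_axioms]])

lemma measurable_F_M: "f \<in> borel_measurable (F s) \<Longrightarrow> f \<in> borel_measurable M"
  by (rule measurable_from_subalg[OF subalg])

lemma emp_mean_measurable: "s \<le> t \<Longrightarrow> emp_mean X s \<in> borel_measurable (F t)"
  unfolding emp_mean_def[abs_def]
  by (cases "s = 0")
     (auto intro!: borel_measurable_scaleR borel_measurable_sum measurable_F_mono[OF X_adapted])

lemma S_proc_adapted: "adapted_to F (S_proc M F X)"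
  unfolding adapted_to_def S_proc_def[abs_def]
  by (auto intro!: borel_measurable_sum borel_measurable_diff measurable_F_mono[OF X_adapted]
      measurable_F_mono[OF borel_measurable_vec_cond_exp])

lemma V_proc_adapted: "adapted_to F (V_proc X)"
  unfolding adapted_to_def V_proc_def[abs_def]
  by (auto intro!: borel_measurable_sum borel_measurable_outer_prod borel_measurable_diff
      measurable_F_mono[OF X_adapted] emp_mean_measurable)

lemma AE_X_bounded: "AE \<omega> in M. \<forall>t\<ge>1. norm (X t \<omega>) \<le> 1 / 2"
  using X_bounded by (simp add: AE_all_countable)

lemma norm_emp_mean_le:
  assumes "\<forall>t\<ge>1. norm (X t \<omega>) \<le> 1 / 2"
  shows "norm (emp_mean X t \<omega>) \<le> 1 / 2"
proof (cases "t = 0")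
  case False
  have "norm (\<Sum>s=1..t. X s \<omega>) \<le> (\<Sum>s=1..t. 1 / 2 :: real)"
    using assms by (intro sum_norm_le) auto
  then show ?thesis using False by (simp add: emp_mean_def field_simps)
qed (simp add: emp_mean_def)

lemma inner_vec_cond_exp_X:
  assumes \<nu>: "norm \<nu> = 1" and t: "t \<ge> 1"
  shows "AE \<omega> in M. \<nu> \<bullet> vec_cond_exp M (F s) (X t) \<omega> = real_cond_exp M (F s) (\<lambda>\<omega>. \<nu> \<bullet> X t \<omega>) \<omega>
      \<and> \<bar>\<nu> \<bullet> vec_cond_exp M (F s) (X t) \<omega>\<bar> \<le> 1 / 2"
proof -
  interpret G: sigma_finite_subalgebra M "F s" by (rule sigma_finite_F)
  have [measurable]: "X t \<in> borel_measurable M" using X_adapted[OF t] by (rule measurable_F_M)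
  have "integrable M (\<lambda>\<omega>. X t \<omega> $ i)" for i
  proof (rule integrable_const_bound[of _ "1/2"])
    show "AE \<omega> in M. norm (X t \<omega> $ i) \<le> 1 / 2"
      using X_bounded[OF t]
      by eventually_elim (metis component_le_norm_cart order_trans real_norm_def)
  qed measurable
  then have eq: "AE \<omega> in M. \<nu> \<bullet> vec_cond_exp M (F s) (X t) \<omega> = real_cond_exp M (F s) (\<lambda>\<omega>. \<nu> \<bullet> X t \<omega>) \<omega>"
    by (rule inner_vec_cond_exp[OF sigma_finite_F])
  have bd: "AE \<omega> in M. \<bar>\<nu> \<bullet> X t \<omega>\<bar> \<le> 1 / 2"
    using X_bounded[OF t] by eventually_elim (rule abs_inner_unit_le[OF \<nu>])
  then have int: "integrable M (\<lambda>\<omega>. \<nu> \<bullet> X t \<omega>)"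
    by (intro integrable_const_bound[of _ "1/2"]) auto
  have const: "AE \<omega> in M. real_cond_exp M (F s) (\<lambda>_. c) \<omega> = c" for c :: real
    by (intro G.real_cond_exp_F_meas) auto
  have up: "AE \<omega> in M. real_cond_exp M (F s) (\<lambda>\<omega>. \<nu> \<bullet> X t \<omega>) \<omega> \<le> real_cond_exp M (F s) (\<lambda>_. 1 / 2) \<omega>"
    using bd by (intro G.real_cond_exp_mono int) (auto elim!: AE_mp)
  have lo: "AE \<omega> in M. real_cond_exp M (F s) (\<lambda>_. - 1 / 2) \<omega> \<le> real_cond_exp M (F s) (\<lambda>\<omega>. \<nu> \<bullet> X t \<omega>) \<omega>"
    using bd by (intro G.real_cond_exp_mono int) (auto elim!: AE_mp)
  show ?thesis
    using eq up lo const[of "1/2"] const[of "-1/2"] by eventually_elim auto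
qed

definition exp_process :: "real^'n \<Rightarrow> real \<Rightarrow> nat \<Rightarrow> 'a \<Rightarrow> real" where
  "exp_process \<nu> l t \<omega> =
     exp (l * (\<nu> \<bullet> S_proc M F X t \<omega>) - psi_E l * (\<nu> \<bullet> (V_proc X t \<omega> *v \<nu>)))"

lemma exp_process_measurable: "exp_process \<nu> l t \<in> borel_measurable (F t)"
proof -
  have [measurable]: "S_proc M F X t \<in> borel_measurable (F t)" "V_proc X t \<in> borel_measurable (F t)"
    using S_proc_adapted V_proc_adapted by (auto simp: adapted_to_def)
  show ?thesis unfolding exp_process_def by measurable
qed

text \<open>The crude bound \<open>exp t\<close> serves integrability only: each increment of
  \<open>\<nu> \<bullet> S\<close> is at most one, and the variance term only decreases the
  exponent.\<close>

lemma exp_process_bounded: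
  assumes \<nu>: "norm \<nu> = 1" and l: "0 \<le> l" "l < 1"
  shows "AE \<omega> in M. exp_process \<nu> l t \<omega> \<le> exp (real t)"
proof -
  have "AE \<omega> in M. \<forall>s\<in>{1..t}. \<bar>\<nu> \<bullet> vec_cond_exp M (F (s - 1)) (X s) \<omega>\<bar> \<le> 1 / 2"
    using inner_vec_cond_exp_X[OF \<nu>] by (intro AE_finite_allI) (auto elim!: AE_mp)
  with AE_X_bounded show ?thesis
  proof eventually_elim
    case (elim \<omega>)
    have "\<nu> \<bullet> S_proc M F X t \<omega> = (\<Sum>s=1..t. \<nu> \<bullet> X s \<omega> - \<nu> \<bullet> vec_cond_exp M (F (s - 1)) (X s) \<omega>)"
      by (simp add: S_proc_def inner_sum_right inner_diff_right)
    also have "\<dots> \<le> (\<Sum>s=1..t. 1)"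
    proof (rule sum_mono)
      fix s assume s: "s \<in> {1..t}"
      have "\<bar>\<nu> \<bullet> X s \<omega>\<bar> \<le> 1 / 2" using elim(1) s by (intro abs_inner_unit_le[OF \<nu>]) auto
      moreover have "\<bar>\<nu> \<bullet> vec_cond_exp M (F (s - 1)) (X s) \<omega>\<bar> \<le> 1 / 2" using elim(2) s by blast
      ultimately show "\<nu> \<bullet> X s \<omega> - \<nu> \<bullet> vec_cond_exp M (F (s - 1)) (X s) \<omega> \<le> 1" by linarith
    qed
    finally have S: "\<nu> \<bullet> S_proc M F X t \<omega> \<le> real t" by simp
    have "l * (\<nu> \<bullet> S_proc M F X t \<omega>) \<le> l * real t" using S l by (intro mult_left_mono)
    also have "\<dots> \<le> real t" using l by (simp add: mult_left_le_one_le)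
    finally have "l * (\<nu> \<bullet> S_proc M F X t \<omega>) \<le> real t" .
    moreover have "0 \<le> psi_E l * (\<nu> \<bullet> (V_proc X t \<omega> *v \<nu>))"
      using psi_E_nonneg[OF l(2)] psd_V_proc[of X t \<omega>] by (simp add: psd_def)
    ultimately show ?case by (simp add: exp_process_def)
  qed
qed

lemma exp_process_integrable:
  assumes "norm \<nu> = 1" "0 \<le> l" "l < 1"
  shows "integrable M (exp_process \<nu> l t)"
  using exp_process_bounded[OF assms] measurable_F_M[OF exp_process_measurable]
  by (intro integrable_const_bound[of _ "exp (real t)"]) (simp_all add: exp_process_def)

text \<open>Write \<open>Y\<close> for the new observation along \<open>\<nu>\<close>, \<open>m\<close>
  for the running mean and \<open>E\<close> for the conditional mean. The exponent grows by
  \<open>l * (m - E)\<close>, which is predictable, plus \<open>l * (Y - m) - psi_E l * (Y -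
  m)\<^sup>2\<close>, to which Fan's inequality applies. What remains is \<open>exp (l * (m
  - E)) * (1 + l * (E - m)) \<le> 1\<close>. Centring the variance at \<open>m\<close>
  instead of \<open>E\<close> therefore costs nothing.\<close>

lemma exp_process_one_step:
  assumes \<nu>: "norm \<nu> = 1" and l: "0 \<le> l" "l < 1"
  shows "AE \<omega> in M. real_cond_exp M (F t) (exp_process \<nu> l (Suc t)) \<omega> \<le> exp_process \<nu> l t \<omega>"
proof -
  interpret G: sigma_finite_subalgebra M "F t" by (rule sigma_finite_F)
  define Y where "Y = (\<lambda>\<omega>. \<nu> \<bullet> X (Suc t) \<omega>)"
  define m where "m = (\<lambda>\<omega>. \<nu> \<bullet> emp_mean X t \<omega>)"
  define E where "E = (\<lambda>\<omega>. \<nu> \<bullet> vec_cond_exp M (F t) (X (Suc t)) \<omega>)"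
  define G where "G = (\<lambda>\<omega>. exp_process \<nu> l t \<omega> * exp (l * (m \<omega> - E \<omega>)))"
  define H where "H = (\<lambda>\<omega>. (1 - l * m \<omega>) + l * Y \<omega>)"
  have YM [measurable]: "Y \<in> borel_measurable M"
    unfolding Y_def using measurable_F_M[OF X_adapted[of "Suc t"]] by simp
  have mF [measurable]: "m \<in> borel_measurable (F t)"
    unfolding m_def by (intro borel_measurable_inner borel_measurable_const emp_mean_measurable order_refl)
  have EF [measurable]: "E \<in> borel_measurable (F t)"
    unfolding E_def by (intro borel_measurable_inner borel_measurable_const borel_measurable_vec_cond_exp)
  have [measurable]: "m \<in> borel_measurable M" "E \<in> borel_measurable M"
    by (rule measurable_F_M[OF mF], rule measurable_F_M[OF EF])
  have LF [measurable]: "exp_process \<nu> l t \<in> borel_measurable (F t)" for t by (rule exp_process_measurable)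
  have LM [measurable]: "exp_process \<nu> l t \<in> borel_measurable M" for t by (rule measurable_F_M[OF LF])
  have GF [measurable]: "G \<in> borel_measurable (F t)" unfolding G_def by measurable
  have [measurable]: "G \<in> borel_measurable M" by (rule measurable_F_M[OF GF])
  have [measurable]: "H \<in> borel_measurable M" unfolding H_def by measurable
  have Suc_t: "Suc t \<ge> 1" by simp
  have bounds: "AE \<omega> in M. \<bar>Y \<omega>\<bar> \<le> 1 / 2 \<and> \<bar>m \<omega>\<bar> \<le> 1 / 2 \<and> \<bar>E \<omega>\<bar> \<le> 1 / 2
      \<and> E \<omega> = real_cond_exp M (F t) Y \<omega> \<and> exp_process \<nu> l t \<omega> \<le> exp (real t)"
    using AE_X_bounded inner_vec_cond_exp_X[OF \<nu> Suc_t, of t] exp_process_bounded[OF \<nu> l, of t]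
  proof eventually_elim
    case (elim \<omega>)
    have "\<bar>Y \<omega>\<bar> \<le> 1 / 2" unfolding Y_def using elim(1) by (intro abs_inner_unit_le[OF \<nu>]) simp
    moreover have "\<bar>m \<omega>\<bar> \<le> 1 / 2"
      unfolding m_def by (intro abs_inner_unit_le[OF \<nu>] norm_emp_mean_le elim(1))
    moreover have "E \<omega> = real_cond_exp M (F t) Y \<omega>" "\<bar>E \<omega>\<bar> \<le> 1 / 2"
      using elim(2) unfolding E_def Y_def by blast+
    ultimately show ?case using elim(3) by blast
  qed
  have Ypos: "\<bar>l * (a - b)\<bar> \<le> 1" if "\<bar>a\<bar> \<le> 1 / 2" "\<bar>b\<bar> \<le> 1 / 2" for a b :: real
  proof -
    have "\<bar>l * (a - b)\<bar> = l * \<bar>a - b\<bar>" using l by (simp add: abs_mult)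
    also have "\<dots> \<le> 1 * 1" using l that by (intro mult_mono) auto
    finally show ?thesis by simp
  qed
  \<comment> \<open>Fan's inequality replaces the increment by an affine function of \<open>Y\<close>, whose
      conditional expectation is explicit.\<close>
  have fan: "AE \<omega> in M. exp_process \<nu> l (Suc t) \<omega> \<le> G \<omega> * H \<omega>"
    using bounds
  proof eventually_elim
    case (elim \<omega>)
    have ge: "- 1 \<le> Y \<omega> - m \<omega>" using elim by (auto simp: abs_le_iff)
    have "l * (Y \<omega> - m \<omega>) - psi_E l * (Y \<omega> - m \<omega>)\<^sup>2 \<le> ln (1 + l * (Y \<omega> - m \<omega>))"
      by (rule fan_inequality[OF l ge])
    moreover have "0 < 1 + l * (Y \<omega> - m \<omega>)"
      using mult_left_mono[OF ge l(1)] l(2) by simp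
    ultimately have "exp (l * (Y \<omega> - m \<omega>) - psi_E l * (Y \<omega> - m \<omega>)\<^sup>2) \<le> 1 + l * (Y \<omega> - m \<omega>)"
      by (simp only: ln_ge_iff)
    also have "\<dots> = H \<omega>" by (simp add: H_def algebra_simps)
    finally have "G \<omega> * exp (l * (Y \<omega> - m \<omega>) - psi_E l * (Y \<omega> - m \<omega>)\<^sup>2) \<le> G \<omega> * H \<omega>"
      by (intro mult_left_mono) (simp_all add: G_def exp_process_def)
    moreover have "exp_process \<nu> l (Suc t) \<omega>
        = G \<omega> * exp (l * (Y \<omega> - m \<omega>) - psi_E l * (Y \<omega> - m \<omega>)\<^sup>2)"
      unfolding exp_process_def G_def V_proc_quadratic_form
      by (simp add: exp_add[symmetric] S_proc_def Y_def m_def E_def inner_add_right inner_diff_right algebra_simps)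
    ultimately show ?case by simp
  qed
  have intY: "integrable M Y"
    using bounds by (intro integrable_const_bound[of _ "1/2"]) (auto elim!: AE_mp)
  have intm: "integrable M (\<lambda>\<omega>. 1 - l * m \<omega>)"
  proof -
    have "integrable M m" using bounds by (intro integrable_const_bound[of _ "1/2"]) (auto elim!: AE_mp)
    then show ?thesis by simp
  qed
  have intGH: "integrable M (\<lambda>\<omega>. G \<omega> * H \<omega>)"
  proof (rule integrable_const_bound[of _ "exp (real t) * exp 1 * 2"])
    show "AE \<omega> in M. norm (G \<omega> * H \<omega>) \<le> exp (real t) * exp 1 * 2"
      using bounds
    proof eventually_elim
      case (elim \<omega>)
      have "l * (m \<omega> - E \<omega>) \<le> 1" using Ypos[of "m \<omega>" "E \<omega>"] elim by auto
      then have "\<bar>G \<omega>\<bar> \<le> exp (real t) * exp 1"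
        unfolding G_def using elim by (auto simp: abs_mult exp_process_def intro!: mult_mono)
      moreover have "\<bar>H \<omega>\<bar> \<le> 2"
        using Ypos[of "Y \<omega>" "m \<omega>"] elim by (auto simp: H_def algebra_simps)
      ultimately show ?case unfolding real_norm_def abs_mult by (intro mult_mono) auto
    qed
  qed measurable
  have "AE \<omega> in M. real_cond_exp M (F t) (exp_process \<nu> l (Suc t)) \<omega>
      \<le> real_cond_exp M (F t) (\<lambda>\<omega>. G \<omega> * H \<omega>) \<omega>"
    by (intro G.real_cond_exp_mono fan exp_process_integrable[OF \<nu> l] intGH)
  moreover have "AE \<omega> in M. real_cond_exp M (F t) (\<lambda>\<omega>. G \<omega> * H \<omega>) \<omega> = G \<omega> * real_cond_exp M (F t) H \<omega>"
    by (intro G.real_cond_exp_mult intGH) measurable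
  moreover have "AE \<omega> in M. real_cond_exp M (F t) H \<omega>
      = real_cond_exp M (F t) (\<lambda>\<omega>. 1 - l * m \<omega>) \<omega> + real_cond_exp M (F t) (\<lambda>\<omega>. l * Y \<omega>) \<omega>"
    unfolding H_def using intm intY by (intro G.real_cond_exp_add) simp_all
  moreover have "AE \<omega> in M. real_cond_exp M (F t) (\<lambda>\<omega>. 1 - l * m \<omega>) \<omega> = 1 - l * m \<omega>"
    by (intro G.real_cond_exp_F_meas intm) measurable
  moreover have "AE \<omega> in M. real_cond_exp M (F t) (\<lambda>\<omega>. l * Y \<omega>) \<omega> = l * real_cond_exp M (F t) Y \<omega>"
    by (intro G.real_cond_exp_cmult intY)
  ultimately show ?thesis using bounds
  proof eventually_elim
    case (elim \<omega>)
    have "real_cond_exp M (F t) H \<omega> = 1 + l * (E \<omega> - m \<omega>)" using elim by (simp add: algebra_simps)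
    also have "\<dots> \<le> exp (l * (E \<omega> - m \<omega>))" by (rule exp_ge_add_one_self)
    finally have "G \<omega> * real_cond_exp M (F t) H \<omega> \<le> G \<omega> * exp (l * (E \<omega> - m \<omega>))"
      by (intro mult_left_mono) (simp_all add: G_def exp_process_def)
    also have "\<dots> = exp_process \<nu> l t \<omega>"
      by (simp add: G_def mult.assoc exp_add[symmetric] algebra_simps)
    finally show ?case using elim by linarith
  qed
qed

lemma exp_process_supermartingale:
  assumes "norm \<nu> = 1" "0 \<le> l" "l < 1"
  shows "supermartingale M F (exp_process \<nu> l)"
  by (intro supermartingaleI_one_step prob_space_axioms filtration_axioms subalg
      exp_process_integrable[OF assms] exp_process_one_step[OF assms])
     (simp add: adapted_to_def exp_process_measurable)

theorem sub_psi_S_V: "sub_psi M F 1 psi_E (S_proc M F X) (V_proc X)"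
  unfolding sub_psi_def
proof (intro conjI allI ballI impI)
  fix \<nu> :: "real^'n" and l :: real
  assume \<nu>: "\<nu> \<in> sphere 0 1" and l: "0 \<le> l \<and> ereal l < 1"
  then have "norm \<nu> = 1" "0 \<le> l" "l < 1" by auto
  note sm = exp_process_supermartingale[OF this]
  have "integral\<^sup>L M (exp_process \<nu> l 0) \<le> 1"
    by (simp add: exp_process_def[abs_def] S_proc_def V_proc_def prob_space)
  then show "\<exists>L. supermartingale M F L \<and> (\<forall>t. \<forall>\<omega>\<in>space M. 0 \<le> L t \<omega>) \<and> integral\<^sup>L M (L 0) \<le> 1 \<and>
      (AE \<omega> in M. \<forall>t. exp (l * (\<nu> \<bullet> S_proc M F X t \<omega>) - psi_E l * (\<nu> \<bullet> (V_proc X t \<omega> *v \<nu>))) \<le> L t \<omega>)"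
    using sm by (intro exI[of _ "exp_process \<nu> l"]) (simp add: exp_process_def)
qed (use psi_E_nonneg S_proc_adapted V_proc_adapted psd_V_proc in auto)

end

section \<open>From a matrix norm to finitely many directions\<close>

text \<open>Let \<open>\<theta>\<close> be the direction of \<open>u = inv_sqrt_mat W *v s\<close>, and
  let \<open>\<nu>'\<close> be the unit vector with \<open>R *v \<nu>' = a *\<^sub>R
  \<theta>\<close>, where \<open>R\<close> is the square root of \<open>W\<close>. Since
  \<open>a \<ge> sqrt (gamma_min W)\<close>, an error of \<open>\<eta>\<close> in
  \<open>\<nu>'\<close> moves the image by at most \<open>sqrt (gamma_max W) * \<eta> \<le>
  \<epsilon> * sqrt (gamma_min W) \<le> \<epsilon> * a\<close>. A vector within
  \<open>\<epsilon> * a\<close> of \<open>a *\<^sub>R \<theta>\<close> makes an angle with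
  \<open>\<theta>\<close> whose cosine is at least \<open>sqrt (1 - \<epsilon>\<^sup>2)
  \<ge> 1 - \<epsilon>\<close>. Estimating the angle, and not the length, avoids a factor
  \<open>1 + \<epsilon>\<close> in the denominator.\<close>

lemma covering_direction:
  fixes W :: "real^'n^'n"
  assumes sym: "transpose W = W" and pos: "0 < gamma_min W"
    and \<epsilon>: "0 < \<epsilon>" "\<epsilon> < 1"
    and K: "\<And>x. norm x = 1 \<Longrightarrow> \<exists>y\<in>K. norm (x - y) \<le> \<eta>"
    and \<eta>: "\<eta> \<le> \<epsilon> / sqrt (cond_number W)"
    and u: "inv_sqrt_mat W *v s \<noteq> 0"
  shows "\<exists>\<nu>\<in>K. (1 - \<epsilon>) * sqrt (\<nu> \<bullet> (W *v \<nu>)) * norm (inv_sqrt_mat W *v s) \<le> \<nu> \<bullet> s"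
proof -
  obtain g v where d: "spectral_decomp W g v" using spectral_decomp_exists[OF sym] .
  have on: "\<forall>i j. v i \<bullet> v j = (if i = j then 1 else 0)" using d by (simp add: spectral_decomp_def)
  have g: "0 < g i" for i
    using pos by (auto simp: gamma_spectral_decomp[OF d] Min_gr_iff)
  define Q where "Q = inv_sqrt_mat W"
  define R where "R = spectral_fun sqrt W"
  have RQ: "R *v (Q *v x) = x" for x
    using g unfolding R_def Q_def inv_sqrt_mat_def spectral_fun_mult_mult[OF sym]
    unfolding spectral_decomp_fun_mult[OF d]
    by (simp add: orthonormal_family_expand[OF on] less_imp_neq[THEN not_sym])
  have R_sym: "x \<bullet> (R *v y) = (R *v x) \<bullet> y" for x y
    unfolding R_def by (intro symmetric_matrix_inner spectral_fun_symmetric sym)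
  have R_norm: "(norm (R *v x))\<^sup>2 = x \<bullet> (W *v x)" for x
  proof -
    have "R *v (R *v x) = W *v x"
      unfolding R_def spectral_fun_mult_mult[OF sym]
      unfolding spectral_decomp_fun_mult[OF d] spectral_decomp_mult[OF d]
      using g by (intro sum.cong) (simp_all add: less_imp_le)
    then show ?thesis using R_sym[of x "R *v x"] by (simp add: power2_norm_eq_inner)
  qed
  define u where "u = Q *v s"
  have u0: "norm u > 0" using u by (simp add: u_def Q_def)
  define \<theta> where "\<theta> = (1 / norm u) *\<^sub>R u"
  have \<theta>: "norm \<theta> = 1" using u0 by (simp add: \<theta>_def)
  define p where "p = Q *v \<theta>"
  have "p \<noteq> 0" using RQ[of \<theta>] \<theta> by (auto simp: p_def)
  then have p0: "norm p > 0" by simp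
  define a where "a = 1 / norm p"
  have a0: "0 < a" using p0 by (simp add: a_def)
  \<comment> \<open>The unit vector that \<open>R\<close> maps onto the ray of \<open>u\<close>.\<close>
  define \<nu>' where "\<nu>' = a *\<^sub>R p"
  have \<nu>': "norm \<nu>' = 1" using p0 by (simp add: \<nu>'_def a_def)
  have R\<nu>': "R *v \<nu>' = a *\<^sub>R \<theta>" by (simp add: \<nu>'_def matrix_vector_mult_scaleR p_def RQ)
  have "gamma_min W \<le> a\<^sup>2"
  proof -
    have "gamma_min W * (\<nu>' \<bullet> \<nu>') \<le> \<nu>' \<bullet> (W *v \<nu>')" using gamma_min_ge_iff[OF sym, of "gamma_min W"] by simp
    then show ?thesis using \<nu>' \<theta> by (simp add: R_norm[symmetric] R\<nu>' norm_eq_1)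
  qed
  then have ga: "sqrt (gamma_min W) \<le> a" using a0 real_sqrt_le_mono[of "gamma_min W" "a\<^sup>2"] by simp
  obtain \<nu> where \<nu>: "\<nu> \<in> K" "norm (\<nu>' - \<nu>) \<le> \<eta>" using K[OF \<nu>'] by blast
  define w where "w = R *v \<nu>"
  have "norm (w - a *\<^sub>R \<theta>) \<le> \<epsilon> * a"
  proof -
    have gm: "0 < gamma_max W" using gamma_min_le_gamma_max[OF sym] pos by linarith
    have "w - a *\<^sub>R \<theta> = R *v (\<nu> - \<nu>')" by (simp add: w_def R\<nu>'[symmetric] matrix_vector_mult_diff_distrib)
    then have "(norm (w - a *\<^sub>R \<theta>))\<^sup>2 = (\<nu> - \<nu>') \<bullet> (W *v (\<nu> - \<nu>'))" by (simp only: R_norm)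
    also have "\<dots> \<le> gamma_max W * ((\<nu> - \<nu>') \<bullet> (\<nu> - \<nu>'))"
      using gamma_max_le_iff[OF sym, of "gamma_max W"] by simp
    also have "\<dots> = (sqrt (gamma_max W) * norm (\<nu> - \<nu>'))\<^sup>2"
      using gm by (simp add: power_mult_distrib power2_norm_eq_inner)
    finally have "norm (w - a *\<^sub>R \<theta>) \<le> sqrt (gamma_max W) * norm (\<nu> - \<nu>')"
      by (rule power2_le_imp_le) (use gm in simp)
    also have "\<dots> \<le> sqrt (gamma_max W) * (\<epsilon> / sqrt (cond_number W))"
      using \<nu>(2) \<eta> gm by (intro mult_left_mono) (auto simp: norm_minus_commute)
    also have "\<dots> = \<epsilon> * sqrt (gamma_min W)"
      using gm pos by (simp add: cond_number_def real_sqrt_divide)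
    also have "\<dots> \<le> \<epsilon> * a" using ga \<epsilon> by simp
    finally show ?thesis .
  qed
  then have "(norm (w - a *\<^sub>R \<theta>))\<^sup>2 \<le> (\<epsilon> * a)\<^sup>2" by (rule power_mono) simp
  moreover have "(norm (w - a *\<^sub>R \<theta>))\<^sup>2 = (norm w)\<^sup>2 - 2 * a * (w \<bullet> \<theta>) + a\<^sup>2"
  proof -
    have "(norm (w - a *\<^sub>R \<theta>))\<^sup>2 = w \<bullet> w - 2 * a * (w \<bullet> \<theta>) + a * a * (\<theta> \<bullet> \<theta>)"
      unfolding power2_norm_eq_inner
      by (simp add: inner_diff_left inner_diff_right inner_commute[of \<theta> w] algebra_simps)
    then show ?thesis using \<theta> by (simp add: norm_eq_1 power2_norm_eq_inner power2_eq_square[of a])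
  qed
  ultimately have "(norm w)\<^sup>2 + (1 - \<epsilon>\<^sup>2) * a\<^sup>2 \<le> 2 * a * (w \<bullet> \<theta>)"
    by (simp add: power_mult_distrib algebra_simps)
  moreover have "(1 - \<epsilon>)\<^sup>2 * a\<^sup>2 \<le> (1 - \<epsilon>\<^sup>2) * a\<^sup>2"
    using \<epsilon> by (intro mult_right_mono) (simp_all add: power2_eq_square algebra_simps mult_left_le)
  \<comment> \<open>The arithmetic-geometric mean inequality turns the sum of squares into a product that
      contains the factor \<open>a\<close> of the right-hand side.\<close>
  moreover have "2 * norm w * ((1 - \<epsilon>) * a) \<le> (norm w)\<^sup>2 + ((1 - \<epsilon>) * a)\<^sup>2"
    by (rule sum_squares_bound)
  moreover have "((1 - \<epsilon>) * a)\<^sup>2 = (1 - \<epsilon>)\<^sup>2 * a\<^sup>2" by (rule power_mult_distrib)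
  ultimately have "2 * norm w * ((1 - \<epsilon>) * a) \<le> 2 * a * (w \<bullet> \<theta>)" by linarith
  then have "a * (2 * ((1 - \<epsilon>) * norm w)) \<le> a * (2 * (w \<bullet> \<theta>))" by (simp only: mult_ac)
  then have "(1 - \<epsilon>) * norm w \<le> w \<bullet> \<theta>" using a0 by simp
  then have "(1 - \<epsilon>) * norm w * norm u \<le> (w \<bullet> \<theta>) * norm u" by (rule mult_right_mono) simp
  also have "(w \<bullet> \<theta>) * norm u = w \<bullet> u" using u0 by (simp add: \<theta>_def)
  also have "\<dots> = \<nu> \<bullet> s" by (simp add: w_def R_sym[symmetric] u_def RQ)
  finally have "(1 - \<epsilon>) * norm w * norm u \<le> \<nu> \<bullet> s" .
  moreover have "norm w = sqrt (\<nu> \<bullet> (W *v \<nu>))"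
    by (simp add: w_def R_norm[symmetric])
  ultimately show ?thesis using \<nu>(1) by (intro bexI[of _ \<nu>]) (simp_all add: u_def Q_def)
qed

section \<open>Stitching over scales\<close>

text \<open>The deterministic core of the stitching argument. Here \<open>r\<close> is the lower end of
  a scale, \<open>q\<close> a variance in that scale, \<open>g\<close> the smallest
  eigenvalue, and \<open>l\<close> the logarithmic level of the line. By
  \<open>psi_E_legendre_scale\<close> with \<open>c = sqrt (g / q)\<close>, the hypothesis
  on \<open>s\<close> gives \<open>s \<ge> q * y\<close> for some \<open>y\<close> with
  \<open>psi_E_legendre y \<ge> C / q \<ge> l / r\<close>. The line that is optimal for
  \<open>x\<close>, where \<open>psi_E_legendre x = l / r\<close>, then has height at least
  \<open>q * (l / r) \<ge> l\<close>.\<close>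

lemma stitched_line_crossing:
  fixes g q r s l \<alpha> C :: real
  defines "x \<equiv> psi_E_conj_inv (l / r)"
  assumes g: "0 < g" "g \<le> q" and r: "0 < r" "r \<le> q" "q \<le> \<alpha> * r"
    and l: "0 < l" "\<alpha> * l \<le> C"
    and s: "sqrt q * sqrt g * psi_E_conj_inv (C / g) \<le> s"
  shows "l \<le> x / (1 + x) * s - psi_E (x / (1 + x)) * q"
proof -
  have q: "0 < q" using g by simp
  have \<alpha>: "0 < \<alpha>" using r by (smt (verit) zero_less_mult_pos2)
  have C: "0 < C" using l \<alpha> by (smt (verit) mult_pos_pos)
  have x: "0 \<le> x" "psi_E_legendre x = l / r"
    unfolding x_def using l r by (auto intro: psi_E_conj_inv)
  define z where "z = psi_E_conj_inv (C / g)"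
  have z: "0 \<le> z" "psi_E_legendre z = C / g"
    unfolding z_def using C g by (auto intro: psi_E_conj_inv)
  define c where "c = sqrt (g / q)"
  have c: "0 \<le> c" "c \<le> 1" "c\<^sup>2 = g / q" using g by (auto simp: c_def)
  have "l / r = \<alpha> * l / (\<alpha> * r)" using \<alpha> by simp
  also have "\<dots> \<le> C / q" using l r q \<alpha> C by (intro frac_le) auto
  also have "\<dots> = c\<^sup>2 * psi_E_legendre z" using g q by (simp add: c z)
  also have "\<dots> \<le> psi_E_legendre (c * z)" by (rule psi_E_legendre_scale[OF c(1,2) z(1)])
  finally have "x \<le> c * z"
    using psi_E_legendre_le_iff[of x "c * z"] x c z by simp
  then have "q * x \<le> q * (c * z)" using q by simp
  also have "q * (c * z) = sqrt q * sqrt g * z"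
    using g q by (simp add: c_def real_sqrt_divide field_simps)
  also have "\<dots> \<le> s" using s by (simp add: z_def)
  finally have qs: "q * x \<le> s" .
  have "l = l / r * r" using r by simp
  also have "\<dots> \<le> l / r * q" using r l by (intro mult_left_mono) auto
  also have "\<dots> = (x * (x / (1 + x)) - psi_E (x / (1 + x))) * q"
    using psi_E_legendre_attained[OF x(1)] x(2) by simp
  also have "\<dots> = x / (1 + x) * (q * x) - psi_E (x / (1 + x)) * q"
    by (simp add: left_diff_distrib)
  also have "\<dots> \<le> x / (1 + x) * s - psi_E (x / (1 + x)) * q"
    using qs x(1) by (intro diff_right_mono mult_left_mono) auto
  finally show ?thesis .
qed

lemma geometric_bracket:
  fixes a y :: real
  assumes "1 < a" "1 \<le> y"
  obtains k where "real k \<le> log a y" "a ^ k \<le> y" "y < a ^ Suc k"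
proof
  define k where "k = nat \<lfloor>log a y\<rfloor>"
  have "0 \<le> log a y" using assms by simp
  then have k: "real k \<le> log a y" "log a y < real (Suc k)" unfolding k_def by linarith+
  show "real k \<le> log a y" by (rule k)
  show "a ^ k \<le> y" using k(1) assms by (simp add: le_log_iff powr_realpow)
  show "y < a ^ Suc k" using k(2) assms by (simp add: log_less_iff powr_realpow del: power_Suc of_nat_Suc)
qed

text \<open>The parameters of the boundary: \<open>\<rho>\<close> regularises the variance,
  \<open>\<alpha>\<close> and \<open>\<beta>\<close> are the ratios of the scales for the
  variance and for the square root of the condition number, and \<open>1 / h\<close>
  distributes the error probability over the variance scales.\<close>

locale stitching =
  fixes \<rho> \<alpha> \<beta> \<epsilon> \<delta> :: real and h :: "real \<Rightarrow> real"
  assumes \<rho>: "0 < \<rho>" and \<alpha>: "1 < \<alpha>" and \<beta>: "1 < \<beta>" and \<epsilon>: "0 < \<epsilon>" "\<epsilon> < 1"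
    and \<delta>: "0 < \<delta>" "\<delta> < 1"
    and h_pos: "\<And>x. 0 \<le> x \<Longrightarrow> 0 < h x" and h_mono: "mono_on {0..} h"
    and h_summable: "summable (\<lambda>k. 1 / h (real k))" and h_sum: "(\<Sum>k. 1 / h (real k)) \<le> 1"
begin

text \<open>The term \<open>1 / h 0\<close> of a series of positive terms with sum at most one is at
  most one, and \<open>h\<close> increases.\<close>

lemma one_le_h: "0 \<le> x \<Longrightarrow> 1 \<le> h x"
proof -
  assume x: "0 \<le> x"
  have "(\<Sum>k\<in>{0}. 1 / h (real k)) \<le> (\<Sum>k. 1 / h (real k))"
    using h_pos by (intro sum_le_suminf h_summable) (auto intro: less_imp_le)
  also note h_sum
  finally have "1 \<le> h 0" using h_pos[of 0] by (simp add: divide_le_eq)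
  also have "\<dots> \<le> h x" using x by (intro mono_onD[OF h_mono]) auto
  finally show ?thesis .
qed

lemma weight_pos: "0 < ln (1 / \<delta> * (1 / (1 - 1 / \<beta>)))"
proof -
  have "1 < 1 / \<delta>" using \<delta> by simp
  moreover have "1 < 1 / (1 - 1 / \<beta>)" using \<beta> by (simp add: field_simps)
  ultimately have "1 < 1 / \<delta> * (1 / (1 - 1 / \<beta>))" by (rule less_1_mult)
  then show ?thesis by (rule ln_gt_zero)
qed

lemma gamma_mat_max_bounds:
  assumes "transpose V = V"
  shows "\<rho> \<le> gamma_min (mat_max V \<rho>)" "\<rho> \<le> gamma_max (mat_max V \<rho>)"
    "1 \<le> cond_number (mat_max V \<rho>)"
  using \<rho> one_le_cond_number[OF mat_max_symmetric[OF assms], of \<rho>] by (auto simp: gamma_mat_max[OF assms])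

text \<open>The logarithm of the inverse error probability of one line: \<open>k\<close> indexes the
  scale of the variance, \<open>j\<close> that of the condition number. The type argument
  only fixes the dimension.\<close>

definition level :: "'n::finite itself \<Rightarrow> nat \<Rightarrow> nat \<Rightarrow> real" where
  "level _ j k = ln (h (real k)) + ln (1 / \<delta> * (1 / (1 - 1 / \<beta>)))
     + ln (\<beta> ^ j * real (covering_number (sphere (0 :: real^'n) 1) (\<epsilon> / \<beta> ^ Suc j)))"

lemma covering_number_sphere_pos:
  "0 < b \<Longrightarrow> 1 \<le> real (covering_number (sphere (0 :: real^'n) 1) (\<epsilon> / b))"
  using covering_number_pos[of "sphere (0 :: real^'n) 1" "\<epsilon> / b"] \<epsilon> by simp

lemma level_pos: "0 < level TYPE('n::finite) j k"
proof -
  have "1 * 1 \<le> \<beta> ^ j * real (covering_number (sphere (0 :: real^'n) 1) (\<epsilon> / \<beta> ^ Suc j))"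
    using \<beta> by (intro mult_mono covering_number_sphere_pos one_le_power) auto
  then show ?thesis using weight_pos one_le_h[of "real k"] unfolding level_def
    by (intro add_nonneg_pos add_pos_nonneg) (auto intro: ln_ge_zero)
qed

text \<open>The total error probability of all lines with indices \<open>j\<close> and \<open>k\<close>,
  one for each point of the cover.\<close>

lemma exp_neg_level:
  "exp (- level TYPE('n::finite) j k) * real (covering_number (sphere (0 :: real^'n) 1) (\<epsilon> / \<beta> ^ Suc j))
     = \<delta> * (1 - 1 / \<beta>) * (1 / \<beta>) ^ j * (1 / h (real k))"
proof -
  let ?N = "real (covering_number (sphere (0 :: real^'n) 1) (\<epsilon> / \<beta> ^ Suc j))"
  have N: "1 \<le> ?N" using \<beta> by (intro covering_number_sphere_pos) simp
  have w: "0 < 1 / \<delta> * (1 / (1 - 1 / \<beta>))" using \<delta> \<beta> by (simp add: field_simps)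
  have hk: "0 < h (real k)" by (simp add: h_pos)
  have b: "0 < \<beta> ^ j * ?N" using \<beta> N by (intro mult_pos_pos) auto
  have "exp (level TYPE('n) j k) = h (real k) * (1 / \<delta> * (1 / (1 - 1 / \<beta>))) * (\<beta> ^ j * ?N)"
    unfolding level_def exp_add using w hk b by (simp only: exp_ln)
  then show ?thesis using N \<delta> \<beta> hk by (simp add: exp_minus power_one_over field_simps)
qed

text \<open>\<open>L_fun\<close> evaluates its terms at the actual eigenvalues, which dominate the lower
  ends of their scales. The factor \<open>\<beta>\<close> inside \<open>L_fun\<close> is
  what makes the covering radius \<open>\<epsilon> / (\<beta> * sqrt \<kappa>)\<close> at
  most \<open>\<epsilon> / \<beta> ^ Suc j\<close>, the radius of the cover for scale
  \<open>j\<close>.\<close>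

lemma level_le_L_fun:
  fixes V :: "real^'n^'n"
  assumes sym: "transpose V = V"
    and k: "real k \<le> log \<alpha> (gamma_max (mat_max V \<rho>) / \<rho>)"
    and j: "\<beta> ^ j \<le> sqrt (cond_number (mat_max V \<rho>))"
  shows "level TYPE('n) j k \<le> L_fun h \<alpha> \<beta> \<epsilon> \<delta> \<rho> V"
proof -
  define b where "b = \<beta> * sqrt (cond_number (mat_max V \<rho>))"
  have bj: "\<beta> ^ Suc j \<le> b" using j \<beta> by (simp add: b_def)
  have pj: "1 \<le> \<beta> ^ j" using \<beta> by simp
  have "\<beta> ^ j * 1 \<le> \<beta> ^ j * \<beta>" using pj \<beta> by (intro mult_left_mono) auto
  then have bj': "\<beta> ^ j \<le> b" using bj by (simp add: mult.commute)
  have b0: "0 < b" using bj' pj by linarith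
  have "covering_number (sphere (0 :: real^'n) 1) (\<epsilon> / \<beta> ^ Suc j) \<le> covering_number (sphere (0 :: real^'n) 1) (\<epsilon> / b)"
    using bj b0 \<epsilon> \<beta> by (intro covering_number_antimono divide_left_mono) auto
  then have "\<beta> ^ j * real (covering_number (sphere (0 :: real^'n) 1) (\<epsilon> / \<beta> ^ Suc j))
      \<le> b * real (covering_number (sphere (0 :: real^'n) 1) (\<epsilon> / b))"
    using bj' b0 by (intro mult_mono) auto
  moreover have "0 < \<beta> ^ j * real (covering_number (sphere (0 :: real^'n) 1) (\<epsilon> / \<beta> ^ Suc j))"
    using covering_number_sphere_pos[of "\<beta> ^ Suc j", where 'n = 'n] \<beta> by (intro mult_pos_pos) auto
  moreover have "h (real k) \<le> h (log \<alpha> (gamma_max (mat_max V \<rho>) / \<rho>))"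
    using k by (intro mono_onD[OF h_mono]) auto
  ultimately show ?thesis
    using h_pos[of "real k"] unfolding level_def L_fun_def Let_def b_def[symmetric]
    by (intro add_mono ln_mono order_refl) auto
qed

lemma L_fun_pos:
  fixes V :: "real^'n^'n"
  assumes "transpose V = V"
  shows "0 < L_fun h \<alpha> \<beta> \<epsilon> \<delta> \<rho> V"
proof -
  have "level TYPE('n) 0 0 \<le> L_fun h \<alpha> \<beta> \<epsilon> \<delta> \<rho> V"
    using gamma_mat_max_bounds[OF assms] \<rho> \<alpha> by (intro level_le_L_fun assms) auto
  then show ?thesis using level_pos[of 0 0, where 'n = 'n] by linarith
qed

lemma borel_measurable_L_fun:
  fixes V :: "'a \<Rightarrow> real^'n^'n"
  assumes [measurable]: "V \<in> borel_measurable N"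
    and sym: "\<And>\<omega>. \<omega> \<in> space N \<Longrightarrow> transpose (V \<omega>) = V \<omega>"
  shows "(\<lambda>\<omega>. L_fun h \<alpha> \<beta> \<epsilon> \<delta> \<rho> (V \<omega>)) \<in> borel_measurable N"
    "(\<lambda>\<omega>. gamma_min (mat_max (V \<omega>) \<rho>)) \<in> borel_measurable N"
proof -
  have [measurable]: "(\<lambda>\<omega>. gamma_min (V \<omega>)) \<in> borel_measurable N" "(\<lambda>\<omega>. gamma_max (V \<omega>)) \<in> borel_measurable N"
    using sym by (auto intro!: borel_measurable_gamma_min borel_measurable_gamma_max)
  have "(\<lambda>\<omega>. max (gamma_min (V \<omega>)) \<rho>) \<in> borel_measurable N" by measurable
  then show gmin [measurable]: "(\<lambda>\<omega>. gamma_min (mat_max (V \<omega>) \<rho>)) \<in> borel_measurable N"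
    by (rule measurable_cong[THEN iffD1, rotated]) (simp add: gamma_mat_max sym)
  have "(\<lambda>\<omega>. max (gamma_max (V \<omega>)) \<rho>) \<in> borel_measurable N" by measurable
  then have gmax [measurable]: "(\<lambda>\<omega>. gamma_max (mat_max (V \<omega>) \<rho>)) \<in> borel_measurable N"
    by (rule measurable_cong[THEN iffD1, rotated]) (simp add: gamma_mat_max sym)
  define b where "b = (\<lambda>\<omega>. \<beta> * sqrt (cond_number (mat_max (V \<omega>) \<rho>)))"
  have [measurable]: "b \<in> borel_measurable N" unfolding b_def cond_number_def by measurable
  have b: "1 \<le> b \<omega>" if "\<omega> \<in> space N" for \<omega>
  proof -
    have "1 * 1 \<le> \<beta> * sqrt (cond_number (mat_max (V \<omega>) \<rho>))"
      using \<beta> gamma_mat_max_bounds(3)[OF sym[OF that]] by (intro mult_mono) auto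
    then show ?thesis by (simp add: b_def)
  qed
  have [measurable]: "(\<lambda>\<omega>. h (log \<alpha> (gamma_max (mat_max (V \<omega>) \<rho>) / \<rho>))) \<in> borel_measurable N"
  proof (rule borel_measurable_mono_on_comp[OF h_mono])
    fix \<omega> assume "\<omega> \<in> space N"
    then have "1 \<le> gamma_max (mat_max (V \<omega>) \<rho>) / \<rho>"
      using gamma_mat_max_bounds(2)[OF sym] \<rho> by (simp add: le_divide_eq)
    then show "0 \<le> log \<alpha> (gamma_max (mat_max (V \<omega>) \<rho>) / \<rho>)" using \<alpha> by simp
  qed measurable
  have "mono_on {1..} (\<lambda>y. real (covering_number (sphere (0 :: real^'n) 1) (\<epsilon> / y)))"
    using \<epsilon> by (intro mono_onI of_nat_mono covering_number_antimono divide_left_mono) auto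
  then have [measurable]: "(\<lambda>\<omega>. real (covering_number (sphere (0 :: real^'n) 1) (\<epsilon> / b \<omega>))) \<in> borel_measurable N"
    by (rule borel_measurable_mono_on_comp) (use b in auto)
  show "(\<lambda>\<omega>. L_fun h \<alpha> \<beta> \<epsilon> \<delta> \<rho> (V \<omega>)) \<in> borel_measurable N"
  proof -
    have b_fold: "\<beta> * sqrt (cond_number (mat_max (V \<omega>) \<rho>)) = b \<omega>" for \<omega> by (simp add: b_def)
    show ?thesis unfolding L_fun_def Let_def b_fold by measurable
  qed
qed

lemma borel_measurable_self_normalized:
  fixes V :: "'a \<Rightarrow> real^'n^'n"
  assumes [measurable]: "V \<in> borel_measurable N" "s \<in> borel_measurable N"
    and sym: "\<And>\<omega>. \<omega> \<in> space N \<Longrightarrow> transpose (V \<omega>) = V \<omega>"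
  shows "(\<lambda>\<omega>. norm (inv_sqrt_mat (mat_max (V \<omega>) \<rho>) *v s \<omega>)) \<in> borel_measurable N"
proof -
  have "continuous_on UNIV (\<lambda>x. 1 / sqrt (max x \<rho>))"
    using \<rho> by (intro continuous_intros) (auto simp: max_def)
  then have [measurable]: "(\<lambda>\<omega>. spectral_fun (\<lambda>x. 1 / sqrt (max x \<rho>)) (V \<omega>) *v s \<omega>) \<in> borel_measurable N"
    using sym by (intro borel_measurable_spectral_fun_mult) auto
  have "(\<lambda>\<omega>. norm (spectral_fun (\<lambda>x. 1 / sqrt (max x \<rho>)) (V \<omega>) *v s \<omega>)) \<in> borel_measurable N"
    by measurable
  then show ?thesis
    by (rule measurable_cong[THEN iffD1, rotated])
       (simp add: inv_sqrt_mat_def mat_max_def spectral_fun_spectral_fun sym)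
qed

definition cover :: "nat \<Rightarrow> (real^'n) set" where
  "cover j = (SOME K. finite K \<and> card K = covering_number (sphere (0 :: real^'n) 1) (\<epsilon> / \<beta> ^ Suc j) \<and>
     K \<subseteq> sphere 0 1 \<and> (\<forall>x\<in>sphere 0 1. \<exists>y\<in>K. norm (x - y) \<le> \<epsilon> / \<beta> ^ Suc j))"

lemma cover:
  "finite (cover j :: (real^'n) set)"
  "card (cover j :: (real^'n) set) = covering_number (sphere (0 :: real^'n) 1) (\<epsilon> / \<beta> ^ Suc j)"
  "\<nu> \<in> cover j \<Longrightarrow> norm (\<nu> :: real^'n) = 1"
  "norm (x :: real^'n) = 1 \<Longrightarrow> \<exists>y\<in>cover j. norm (x - y) \<le> \<epsilon> / \<beta> ^ Suc j"
proof -
  have "0 < \<epsilon> / \<beta> ^ Suc j" using \<epsilon> \<beta> by simp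
  from someI_ex[OF covering_number_attained[OF compact_sphere[of "0 :: real^'n" 1] this], folded cover_def]
  show "finite (cover j :: (real^'n) set)"
    "card (cover j :: (real^'n) set) = covering_number (sphere (0 :: real^'n) 1) (\<epsilon> / \<beta> ^ Suc j)"
    "\<nu> \<in> cover j \<Longrightarrow> norm (\<nu> :: real^'n) = 1"
    "norm (x :: real^'n) = 1 \<Longrightarrow> \<exists>y\<in>cover j. norm (x - y) \<le> \<epsilon> / \<beta> ^ Suc j"
    by auto
qed

text \<open>The maximiser of \<open>x * l - psi_E l\<close> at the point \<open>x\<close> where the
  conjugate equals the level divided by the variance at the lower end of the scale.\<close>

definition slope :: "'n::finite itself \<Rightarrow> nat \<Rightarrow> nat \<Rightarrow> real" where
  "slope T j k = (let x = psi_E_conj_inv (level T j k / (\<alpha> ^ k * \<rho>)) in x / (1 + x))"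

lemma slope_bounds: "0 \<le> slope TYPE('n::finite) j k" "slope TYPE('n) j k < 1"
proof -
  have "0 \<le> psi_E_conj_inv (level TYPE('n) j k / (\<alpha> ^ k * \<rho>))"
    using level_pos[of j k, where 'n = 'n] \<alpha> \<rho> by (intro psi_E_conj_inv) simp
  then show "0 \<le> slope TYPE('n::finite) j k" "slope TYPE('n) j k < 1"
    by (simp_all add: slope_def Let_def)
qed

text \<open>Combines the two deterministic steps. The condition number selects \<open>j\<close> and
  hence a cover, whose point \<open>\<nu>\<close> is provided by
  \<open>covering_direction\<close>; then \<open>q = \<nu> \<bullet> (W *v \<nu>)\<close>
  selects \<open>k\<close>. The largest eigenvalue inside \<open>L_fun\<close> enters
  through \<open>q \<le> gamma_max W\<close> and the monotonicity of \<open>h\<close>.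
  Regularisation increases the variance, so the crossing also holds for \<open>V\<close>
  itself.\<close>

lemma boundary_crossing_implies_line_crossing:
  fixes V :: "real^'n^'n"
  assumes sym: "transpose V = V"
  defines "W \<equiv> mat_max V \<rho>"
  assumes cross: "sqrt (gamma_min W) / (1 - \<epsilon>) * psi_E_conj_inv (\<alpha> * L_fun h \<alpha> \<beta> \<epsilon> \<delta> \<rho> V / gamma_min W)
      \<le> norm (inv_sqrt_mat W *v s)"
  shows "\<exists>j k. \<exists>\<nu>\<in>cover j. level TYPE('n) j k
      \<le> slope TYPE('n) j k * (\<nu> \<bullet> s) - psi_E (slope TYPE('n) j k) * (\<nu> \<bullet> (V *v \<nu>))"
proof -
  let ?g = "gamma_min W" and ?C = "\<alpha> * L_fun h \<alpha> \<beta> \<epsilon> \<delta> \<rho> V" and ?u = "norm (inv_sqrt_mat W *v s)"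
  have Wsym: "transpose W = W" unfolding W_def by (rule mat_max_symmetric[OF sym])
  have g: "0 < ?g" "\<rho> \<le> ?g" and \<kappa>: "1 \<le> cond_number W"
    using gamma_mat_max_bounds[OF sym] \<rho> by (auto simp: W_def)
  have C: "0 < ?C" using L_fun_pos[OF sym] \<alpha> by simp
  have "0 < sqrt ?g / (1 - \<epsilon>) * psi_E_conj_inv (?C / ?g)"
    using g C \<epsilon> psi_E_conj_inv_pos[of "?C / ?g"] by simp
  then have u0: "inv_sqrt_mat W *v s \<noteq> 0" using cross by force
  obtain j where j: "\<beta> ^ j \<le> sqrt (cond_number W)" "sqrt (cond_number W) < \<beta> ^ Suc j"
    using geometric_bracket[OF \<beta>, of "sqrt (cond_number W)"] \<kappa> by auto
  \<comment> \<open>The cover of scale \<open>j\<close> is fine enough for every condition number in that scale.\<close>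
  have "\<epsilon> / \<beta> ^ Suc j \<le> \<epsilon> / sqrt (cond_number W)"
    using j \<epsilon> \<kappa> \<beta> by (intro divide_left_mono) auto
  from covering_direction[OF Wsym g(1) \<epsilon> cover(4) this u0]
  obtain \<nu> where \<nu>: "\<nu> \<in> cover j"
    and \<nu>s: "(1 - \<epsilon>) * sqrt (\<nu> \<bullet> (W *v \<nu>)) * ?u \<le> \<nu> \<bullet> s" by blast
  define q where "q = \<nu> \<bullet> (W *v \<nu>)"
  have \<nu>1: "\<nu> \<bullet> \<nu> = 1" using cover(3)[OF \<nu>] by (simp add: norm_eq_1)
  have gq: "?g \<le> q" using gamma_min_ge_iff[OF Wsym, of ?g] \<nu>1 unfolding q_def by (metis order_refl mult_1_right)
  have qG: "q \<le> gamma_max W" using gamma_max_le_iff[OF Wsym, of "gamma_max W"] \<nu>1 unfolding q_def by (metis order_refl mult_1_right)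
  obtain k where k: "real k \<le> log \<alpha> (q / \<rho>)" "\<alpha> ^ k \<le> q / \<rho>" "q / \<rho> < \<alpha> ^ Suc k"
    using geometric_bracket[OF \<alpha>, of "q / \<rho>"] g gq \<rho> by auto
  have "log \<alpha> (q / \<rho>) \<le> log \<alpha> (gamma_max W / \<rho>)"
    using g gq qG \<alpha> \<rho> by (intro log_mono divide_right_mono) auto
  then have lev: "level TYPE('n) j k \<le> L_fun h \<alpha> \<beta> \<epsilon> \<delta> \<rho> V"
    using k(1) j(1) unfolding W_def by (intro level_le_L_fun sym) auto
  have "sqrt q * sqrt ?g * psi_E_conj_inv (?C / ?g)
      = (1 - \<epsilon>) * sqrt q * (sqrt ?g / (1 - \<epsilon>) * psi_E_conj_inv (?C / ?g))"
    using \<epsilon> by simp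
  also have "\<dots> \<le> (1 - \<epsilon>) * sqrt q * ?u" using cross \<epsilon> g gq by (intro mult_left_mono) auto
  also have "\<dots> \<le> \<nu> \<bullet> s" using \<nu>s by (simp add: q_def)
  finally have "level TYPE('n) j k \<le> slope TYPE('n) j k * (\<nu> \<bullet> s) - psi_E (slope TYPE('n) j k) * q"
    unfolding slope_def Let_def
    using g gq k lev level_pos[of j k, where 'n = 'n] \<alpha> \<rho>
    by (intro stitched_line_crossing[where g = ?g and \<alpha> = \<alpha> and C = ?C])
       (auto simp: field_simps intro: less_imp_le)
  also have "\<dots> \<le> slope TYPE('n) j k * (\<nu> \<bullet> s) - psi_E (slope TYPE('n) j k) * (\<nu> \<bullet> (V *v \<nu>))"
    using quadratic_form_le_mat_max[OF sym, of \<nu> \<rho>] psi_E_nonneg[OF slope_bounds(2)]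
    by (intro diff_left_mono mult_left_mono) (auto simp: q_def W_def)
  finally show ?thesis using \<nu> by blast
qed

lemma borel_measurable_boundary_ingredients:
  fixes S :: "nat \<Rightarrow> 'a \<Rightarrow> real^'n"
  assumes "\<And>t. subalgebra M (F t)" and sub: "sub_psi M F lmax \<psi> S V"
  shows "(\<lambda>\<omega>. L_fun h \<alpha> \<beta> \<epsilon> \<delta> \<rho> (V t \<omega>)) \<in> borel_measurable M"
    "(\<lambda>\<omega>. gamma_min (mat_max (V t \<omega>) \<rho>)) \<in> borel_measurable M"
    "(\<lambda>\<omega>. norm (inv_sqrt_mat (mat_max (V t \<omega>) \<rho>) *v S t \<omega>)) \<in> borel_measurable M"
proof -
  have [measurable]: "S t \<in> borel_measurable M" "V t \<in> borel_measurable M" for t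
    by (rule measurable_from_subalg[OF assms(1)[of t]], use sub in \<open>simp add: sub_psi_def adapted_to_def\<close>)+
  have sym: "transpose (V t \<omega>) = V t \<omega>" if "\<omega> \<in> space M" for t \<omega>
    using sub that by (auto simp: sub_psi_def psd_def)
  show "(\<lambda>\<omega>. L_fun h \<alpha> \<beta> \<epsilon> \<delta> \<rho> (V t \<omega>)) \<in> borel_measurable M"
    "(\<lambda>\<omega>. gamma_min (mat_max (V t \<omega>) \<rho>)) \<in> borel_measurable M"
    "(\<lambda>\<omega>. norm (inv_sqrt_mat (mat_max (V t \<omega>) \<rho>) *v S t \<omega>)) \<in> borel_measurable M"
    by (intro borel_measurable_L_fun borel_measurable_self_normalized sym; measurable)+
qed

text \<open>A union bound over the lines: the points of a cover cancel its cardinality, the scales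
  \<open>k\<close> sum to at most one by the choice of \<open>h\<close>, and the scales
  \<open>j\<close> form a geometric series.\<close>

theorem sub_psi_E_self_normalized_bound:
  fixes S :: "nat \<Rightarrow> 'a \<Rightarrow> real^'n"
  assumes "prob_space M" "filtration (space M) F" "\<And>t. subalgebra M (F t)"
    and sub: "sub_psi M F 1 psi_E S V"
  defines "A \<equiv> {\<omega> \<in> space M. \<exists>t. norm (inv_sqrt_mat (mat_max (V t \<omega>) \<rho>) *v S t \<omega>)
      \<ge> sqrt (gamma_min (mat_max (V t \<omega>) \<rho>)) / (1 - \<epsilon>)
        * psi_E_conj_inv (\<alpha> * L_fun h \<alpha> \<beta> \<epsilon> \<delta> \<rho> (V t \<omega>) / gamma_min (mat_max (V t \<omega>) \<rho>))}"
  shows "A \<in> sets M" "measure M A \<le> \<delta>"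
proof -
  interpret prob_space M by fact
  have sym: "transpose (V t \<omega>) = V t \<omega>" if "\<omega> \<in> space M" for t \<omega>
    using sub that by (auto simp: sub_psi_def psd_def)
  note [measurable] = borel_measurable_boundary_ingredients[OF assms(3) sub]
  have [measurable]: "(\<lambda>\<omega>. psi_E_conj_inv (\<alpha> * L_fun h \<alpha> \<beta> \<epsilon> \<delta> \<rho> (V t \<omega>) / gamma_min (mat_max (V t \<omega>) \<rho>)))
      \<in> borel_measurable M" for t
  proof (rule borel_measurable_mono_on_comp[OF psi_E_conj_inv_mono])
    fix \<omega> assume "\<omega> \<in> space M"
    then show "0 \<le> \<alpha> * L_fun h \<alpha> \<beta> \<epsilon> \<delta> \<rho> (V t \<omega>) / gamma_min (mat_max (V t \<omega>) \<rho>)"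
      using L_fun_pos[OF sym] gamma_mat_max_bounds(1)[OF sym] \<alpha> \<rho>
      by (intro divide_nonneg_nonneg mult_nonneg_nonneg) (auto intro: less_imp_le order_trans)
  qed measurable
  show A: "A \<in> sets M" unfolding A_def by measurable
  define E where "E = (\<lambda>j k \<nu>. {\<omega> \<in> space M. \<exists>t. level TYPE('n) j k \<le> slope TYPE('n) j k * (\<nu> \<bullet> S t \<omega>)
      - psi_E (slope TYPE('n) j k) * (\<nu> \<bullet> (V t \<omega> *v \<nu>))})"
  define E2 where "E2 = (\<lambda>j k. \<Union>\<nu>\<in>cover j. E j k \<nu>)"
  define E1 where "E1 = (\<lambda>j. \<Union>k. E2 j k)"
  have E_sets: "E j k \<nu> \<in> sets M" and E_le: "measure M (E j k \<nu>) \<le> exp (- level TYPE('n) j k)"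
    if "\<nu> \<in> cover j" for j k \<nu>
  proof -
    have "ereal (slope TYPE('n) j k) < 1" using slope_bounds(2)[of j k, where 'n = 'n] by simp
    note crossing = sub_psi_line_crossing[OF assms(1-3) sub cover(3)[OF that]
        slope_bounds(1)[of j k, where 'n = 'n] this, of "level TYPE('n) j k"]
    show "E j k \<nu> \<in> sets M" "measure M (E j k \<nu>) \<le> exp (- level TYPE('n) j k)"
      unfolding E_def by (rule crossing(1), rule crossing(2))
  qed
  have E2_sets: "E2 j k \<in> sets M" for j k unfolding E2_def using cover(1) E_sets by (intro sets.finite_UN) auto
  have E1_sets: "E1 j \<in> sets M" for j unfolding E1_def using E2_sets by (intro sets.countable_UN) auto
  have "A \<subseteq> (\<Union>j. E1 j)"
  proof
    fix \<omega> assume "\<omega> \<in> A"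
    then obtain t where \<omega>: "\<omega> \<in> space M" and cross: "sqrt (gamma_min (mat_max (V t \<omega>) \<rho>)) / (1 - \<epsilon>)
        * psi_E_conj_inv (\<alpha> * L_fun h \<alpha> \<beta> \<epsilon> \<delta> \<rho> (V t \<omega>) / gamma_min (mat_max (V t \<omega>) \<rho>))
        \<le> norm (inv_sqrt_mat (mat_max (V t \<omega>) \<rho>) *v S t \<omega>)" by (auto simp: A_def)
    show "\<omega> \<in> (\<Union>j. E1 j)"
      using boundary_crossing_implies_line_crossing[OF sym[OF \<omega>] cross] \<omega>
      by (force simp: E1_def E2_def E_def)
  qed
  then have "measure M A \<le> measure M (\<Union>j. E1 j)"
    using E1_sets by (intro finite_measure_mono sets.countable_UN) auto
  also have "\<dots> \<le> \<delta>"
  proof -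
    let ?c = "\<lambda>j. \<delta> * (1 - 1 / \<beta>) * (1 / \<beta>) ^ j"
    have E2_le: "measure M (E2 j k) \<le> ?c j * (1 / h (real k))" for j k
    proof -
      have "measure M (E2 j k) \<le> (\<Sum>\<nu>\<in>cover j. measure M (E j k \<nu>))"
        unfolding E2_def using E_sets by (intro finite_measure_subadditive_finite cover(1)) auto
      also have "\<dots> \<le> (\<Sum>\<nu>\<in>(cover j :: (real^'n) set). exp (- level TYPE('n) j k))"
        using E_le by (intro sum_mono)
      also have "\<dots> = ?c j * (1 / h (real k))"
        using exp_neg_level[of j k, where 'n = 'n] by (simp add: cover(2) mult.commute)
      finally show ?thesis .
    qed
    have c0: "0 \<le> ?c j" for j using \<delta> \<beta> by simp
    have E1_le: "measure M (E1 j) \<le> ?c j" for j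
    proof -
      have sm: "summable (\<lambda>k. ?c j * (1 / h (real k)))" by (intro summable_mult h_summable)
      have sm2: "summable (\<lambda>k. measure M (E2 j k))"
        using E2_le by (intro summable_comparison_test'[OF sm]) auto
      have "measure M (E1 j) \<le> (\<Sum>k. measure M (E2 j k))"
        unfolding E1_def using E2_sets sm2 by (intro finite_measure_subadditive_countably) auto
      also have "\<dots> \<le> (\<Sum>k. ?c j * (1 / h (real k)))" by (intro suminf_le E2_le sm sm2)
      also have "\<dots> = ?c j * (\<Sum>k. 1 / h (real k))" by (intro suminf_mult h_summable)
      also have "\<dots> \<le> ?c j * 1" using h_sum c0 by (intro mult_left_mono)
      finally show ?thesis by simp
    qed
    have "norm (1 / \<beta>) < 1" using \<beta> by simp
    from geometric_sums[OF this] have "(\<lambda>j. (1 / \<beta>) ^ j) sums (1 / (1 - 1 / \<beta>))" .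
    from sums_mult[OF this, of "\<delta> * (1 - 1 / \<beta>)"] have sums: "?c sums \<delta>" using \<beta> by simp
    have sm: "summable (\<lambda>j. measure M (E1 j))"
      using E1_le by (intro summable_comparison_test'[OF sums_summable[OF sums]]) auto
    have "measure M (\<Union>j. E1 j) \<le> (\<Sum>j. measure M (E1 j))"
      using E1_sets sm by (intro finite_measure_subadditive_countably) auto
    also have "\<dots> \<le> suminf ?c" by (intro suminf_le E1_le sm sums_summable[OF sums])
    also have "\<dots> = \<delta>" by (rule sums_unique[OF sums, symmetric])
    finally show ?thesis .
  qed
  finally show "measure M A \<le> \<delta>" .
qed

lemma boundary_le_explicit:
  fixes V :: "real^'n^'n"
  assumes sym: "transpose V = V"
  shows "sqrt (gamma_min (mat_max V \<rho>)) / (1 - \<epsilon>)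
      * psi_E_conj_inv (\<alpha> * L_fun h \<alpha> \<beta> \<epsilon> \<delta> \<rho> V / gamma_min (mat_max V \<rho>))
    \<le> 1 / (1 - \<epsilon>) * (sqrt (2 * \<alpha> * L_fun h \<alpha> \<beta> \<epsilon> \<delta> \<rho> V)
        + \<alpha> * L_fun h \<alpha> \<beta> \<epsilon> \<delta> \<rho> V / sqrt (gamma_min (mat_max V \<rho>)))"
proof -
  let ?g = "gamma_min (mat_max V \<rho>)" and ?C = "\<alpha> * L_fun h \<alpha> \<beta> \<epsilon> \<delta> \<rho> V"
  have g: "0 < ?g" using gamma_mat_max_bounds(1)[OF sym] \<rho> by linarith
  have C: "0 < ?C" using L_fun_pos[OF sym] \<alpha> by simp
  have "sqrt ?g * psi_E_conj_inv (?C / ?g) \<le> sqrt ?g * (sqrt (2 * (?C / ?g)) + ?C / ?g)"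
    using g C by (intro mult_left_mono psi_E_conj_inv_upper) auto
  also have "\<dots> = sqrt ?g * sqrt (2 * ?C / ?g) + sqrt ?g * (?C / ?g)"
    by (simp add: distrib_left)
  also have "sqrt ?g * sqrt (2 * ?C / ?g) = sqrt (2 * \<alpha> * L_fun h \<alpha> \<beta> \<epsilon> \<delta> \<rho> V)"
    using g by (simp add: real_sqrt_mult[symmetric] mult.assoc)
  also have "sqrt ?g * (?C / ?g) = ?C / sqrt ?g"
    using g by (simp add: field_simps)
  finally show ?thesis using \<epsilon> by (simp add: divide_right_mono)
qed

theorem sub_psi_E_self_normalized_explicit_bound:
  fixes S :: "nat \<Rightarrow> 'a \<Rightarrow> real^'n"
  assumes "prob_space M" "filtration (space M) F" "\<And>t. subalgebra M (F t)"
    and sub: "sub_psi M F 1 psi_E S V"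
  defines "B \<equiv> {\<omega> \<in> space M. \<forall>t. norm (inv_sqrt_mat (mat_max (V t \<omega>) \<rho>) *v S t \<omega>)
      \<le> 1 / (1 - \<epsilon>) * (sqrt (2 * \<alpha> * L_fun h \<alpha> \<beta> \<epsilon> \<delta> \<rho> (V t \<omega>))
        + \<alpha> * L_fun h \<alpha> \<beta> \<epsilon> \<delta> \<rho> (V t \<omega>) / sqrt (gamma_min (mat_max (V t \<omega>) \<rho>)))}"
  shows "B \<in> sets M" "1 - \<delta> \<le> measure M B"
proof -
  interpret prob_space M by fact
  let ?n = "\<lambda>t \<omega>. norm (inv_sqrt_mat (mat_max (V t \<omega>) \<rho>) *v S t \<omega>)"
  let ?ex = "\<lambda>t \<omega>. 1 / (1 - \<epsilon>) * (sqrt (2 * \<alpha> * L_fun h \<alpha> \<beta> \<epsilon> \<delta> \<rho> (V t \<omega>))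
        + \<alpha> * L_fun h \<alpha> \<beta> \<epsilon> \<delta> \<rho> (V t \<omega>) / sqrt (gamma_min (mat_max (V t \<omega>) \<rho>)))"
  let ?bd = "\<lambda>t \<omega>. sqrt (gamma_min (mat_max (V t \<omega>) \<rho>)) / (1 - \<epsilon>)
        * psi_E_conj_inv (\<alpha> * L_fun h \<alpha> \<beta> \<epsilon> \<delta> \<rho> (V t \<omega>) / gamma_min (mat_max (V t \<omega>) \<rho>))"
  define n ex where "n = ?n" and "ex = ?ex"
  have [measurable]: "n t \<in> borel_measurable M" "ex t \<in> borel_measurable M" for t
    unfolding n_def ex_def
    by (intro borel_measurable_boundary_ingredients[OF assms(3) sub] borel_measurable_times borel_measurable_add
        borel_measurable_divide measurable_compose[OF _ borel_measurable_sqrt] borel_measurable_const)+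
  have "{\<omega> \<in> space M. \<forall>t. n t \<omega> \<le> ex t \<omega>} \<in> sets M" by measurable
  then show B: "B \<in> sets M" by (simp only: n_def ex_def B_def)
  let ?A = "{\<omega> \<in> space M. \<exists>t. ?n t \<omega> \<ge> ?bd t \<omega>}"
  note A = sub_psi_E_self_normalized_bound[OF assms(1-3) sub]
  have sym: "transpose (V t \<omega>) = V t \<omega>" if "\<omega> \<in> space M" for t \<omega>
    using sub that by (auto simp: sub_psi_def psd_def)
  have "space M - B \<subseteq> ?A"
  proof
    fix \<omega> assume "\<omega> \<in> space M - B"
    then have \<omega>: "\<omega> \<in> space M" and "\<not> (\<forall>t. ?n t \<omega> \<le> ?ex t \<omega>)" by (auto simp only: B_def)
    then obtain t where "?ex t \<omega> < ?n t \<omega>" by (auto simp only: not_all not_le)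
    then have "?bd t \<omega> \<le> ?n t \<omega>" using boundary_le_explicit[OF sym[OF \<omega>], of t] by linarith
    then show "\<omega> \<in> ?A" using \<omega> by blast
  qed
  then have "measure M (space M - B) \<le> measure M ?A" using A(1) by (rule finite_measure_mono)
  also note A(2)
  finally show "1 - \<delta> \<le> measure M B" using prob_compl[OF B] by linarith
qed

end

section \<open>Empirical Bernstein self-normalized bound\<close>

theorem theorem5p4:
  fixes M :: "'a measure"
    and F :: "nat \<Rightarrow> 'a measure"
    and X :: "nat \<Rightarrow> 'a \<Rightarrow> real^'n"
  assumes "prob_space M"
    and "filtration (space M) F"
    and "\<And>t. subalgebra M (F t)"
    and "\<And>t. t \<ge> 1 \<Longrightarrow> X t \<in> borel_measurable (F t)"
    and "\<And>t. t \<ge> 1 \<Longrightarrow> (AE \<omega> in M. norm (X t \<omega>) \<le> 1 / 2)"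
  shows "sub_psi M F 1 psi_E (S_proc M F X) (V_proc X) \<and>
    (\<forall>(\<rho>::real) (\<alpha>::real) (\<beta>::real) (\<epsilon>::real) (\<delta>::real) (h::real \<Rightarrow> real).
       \<rho> > 0 \<and> \<alpha> > 1 \<and> \<beta> > 1 \<and> 0 < \<epsilon> \<and> \<epsilon> < 1 \<and> 0 < \<delta> \<and> \<delta> < 1 \<and>
       (\<forall>x\<ge>0. h x > 0) \<and> mono_on {0..} h \<and>
       summable (\<lambda>k. 1 / h (real k)) \<and> (\<Sum>k. 1 / h (real k)) \<le> 1 \<longrightarrow>
       (let S = S_proc M F X;
            W = (\<lambda>t \<omega>. mat_max (V_proc X t \<omega>) \<rho>);
            L = (\<lambda>t \<omega>. L_fun h \<alpha> \<beta> \<epsilon> \<delta> \<rho> (V_proc X t \<omega>));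
            A = {\<omega> \<in> space M. \<exists>t.
                   norm (inv_sqrt_mat (W t \<omega>) *v S t \<omega>)
                   \<ge> sqrt (gamma_min (W t \<omega>)) / (1 - \<epsilon>)
                       * psi_E_conj_inv (\<alpha> * L t \<omega> / gamma_min (W t \<omega>))};
            B = {\<omega> \<in> space M. \<forall>t.
                   norm (inv_sqrt_mat (W t \<omega>) *v S t \<omega>)
                   \<le> 1 / (1 - \<epsilon>)
                       * (sqrt (2 * \<alpha> * L t \<omega>) + \<alpha> * L t \<omega> / sqrt (gamma_min (W t \<omega>)))}
        in A \<in> sets M \<and> measure M A \<le> \<delta> \<and>
           B \<in> sets M \<and> measure M B \<ge> 1 - \<delta>))"
proof -
  interpret bounded_adapted_process M F X
    using assms by (simp add: bounded_adapted_process_def bounded_adapted_process_axioms_def)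
  show ?thesis
    unfolding Let_def
    by (intro conjI allI impI sub_psi_S_V
          stitching.sub_psi_E_self_normalized_bound[OF _ assms(1-3) sub_psi_S_V]
          stitching.sub_psi_E_self_normalized_explicit_bound[OF _ assms(1-3) sub_psi_S_V];
        simp add: stitching_def)
qed

end
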